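(* Let $\phi:\mathbb{Z}\to\mathbb{C}$ have admissible support and be such that $\sup_{\xi}|\hat\phi(\xi)|=1$. Let $m=m_\phi$, $\xi_1,\dots,\xi_R$, $\alpha_1,\dots,\alpha_R$ and $\beta_1,\dots,\beta_R$ be the constants associated to $\phi$ as defined in the context. Then to each $\alpha_q$ ($q\in\{1,\dots,R\}$) there exist subcollections $\xi_{j_1},\xi_{j_2},\dots,\xi_{j_{r(q)}}$ of $\xi_1,\dots,\xi_R$ and $\beta_{j_1},\beta_{j_2},\dots,\beta_{j_{r(q)}}$ of $\beta_1,\dots,\beta_R$ (with the same distinct indices $j_1,\dots,j_{r(q)}\in\{1,\dots,R\}$) such that $$\phi^{(n)}(\lfloor\alpha_q n+xn^{1/m}\rfloor)=\sum_{l=1}^{r(q)}n^{-1/m}e^{-i\lfloor\alpha_q n+xn^{1/m}\rfloor\xi_{j_l}}\hat{\phi}(\xi_{j_l})^n H_m^{\beta_{j_l}}(x)+o(n^{-1/m})$$ as $n\to\infty$, uniformly for $x$ in any compact subset of $\mathbb{R}$.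
   Context: A function $\phi:\mathbb{Z}\to\mathbb{C}$ has admissible support if its support is finite and consists of more than one point. The convolution powers are $\phi^{(1)}=\phi$ and $\phi^{(n)}(x)=\sum_{y\in\mathbb{Z}}\phi^{(n-1)}(x-y)\phi(y)$ for $n\ge 2$. The Fourier transform is $\hat{\phi}(\xi)=\sum_{x\in\mathbb{Z}}\phi(x)e^{ix\xi}$, $\xi\in\mathbb{R}$. $\lfloor\cdot\rfloor$ is the greatest integer function. Constants associated to $\phi$ (with admissible support and $\sup_\xi|\hat\phi(\xi)|=1$): let $\Omega=\{\xi'\in(-\pi,\pi]:|\hat\phi(\xi')|=1\}$, which is a finite set. For each $\xi_0\in\Omega$, the Taylor expansion about $\xi=0$ (principal branch of $\log$) has the form $$\log\left(\frac{\hat\phi(\xi+\xi_0)}{\hat\phi(\xi_0)}\right)=i\alpha\xi-\beta\xi^{m}+o(\xi^{m})\quad(\xi\to0),$$ where $m=m(\xi_0)\geq 2$ is an integer, $\alpha=\alpha(\xi_0)\in\mathbb{R}$ and $\beta=\beta(\xi_0)\in\mathbb{C}$ is non-zero with $\Re(\beta)\ge 0$ (and $\Re(\beta)=0$ whenever $m(\xi_0)$ is odd). Set $m_\phi=\max_{\xi_0\in\Omega}m(\xi_0)$, let $\xi_1,\dots,\xi_R$ be the distinct points of $\Omega$ with $m(\xi_q)=m_\phi$, and put $\alpha_q=\alpha(\xi_q)$, $\beta_q=\beta(\xi_q)$ for $q=1,\dots,R$. For an integer $m\ge2$ and non-zero $\beta\in\mathbb{C}$ with $\Re(\beta)\ge0$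 (with $m$ even if $\Re(\beta)>0$), $H_m^{\beta}:\mathbb{R}\to\mathbb{C}$ is defined by the (convergent) improper Riemann integral $H_m^{\beta}(x)=\frac{1}{2\pi}\int_{\mathbb{R}}e^{-ixu}e^{-\beta u^m}\,du$. *)

theory Defs
  imports "HOL-Analysis.Analysis" "HOL-Library.Landau_Symbols"
begin

definition admissible_support :: "(int \<Rightarrow> complex) \<Rightarrow> bool" where
  "admissible_support \<phi> \<longleftrightarrow> finite {x. \<phi> x \<noteq> 0} \<and> card {x. \<phi> x \<noteq> 0} > 1"

(* The value at 0 (the unit mass at the origin) is only a convention;
   convolution powers are meant for exponents at least 1. *)
fun conv_power :: "(int \<Rightarrow> complex) \<Rightarrow> nat \<Rightarrow> int \<Rightarrow> complex" where
  "conv_power \<phi> 0 = (\<lambda>x. if x = 0 then 1 else 0)"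
| "conv_power \<phi> (Suc 0) = \<phi>"
| "conv_power \<phi> (Suc (Suc n)) = (\<lambda>x. \<Sum>\<^sub>\<infinity>y. conv_power \<phi> (Suc n) (x - y) * \<phi> y)"

definition fourier :: "(int \<Rightarrow> complex) \<Rightarrow> real \<Rightarrow> complex" where
  "fourier \<phi> \<xi> = (\<Sum>\<^sub>\<infinity>x. \<phi> x * exp (\<i> * of_int x * of_real \<xi>))"

definition unimodular_points :: "(int \<Rightarrow> complex) \<Rightarrow> real set" where
  "unimodular_points \<phi> = {\<xi>. - pi < \<xi> \<and> \<xi> \<le> pi \<and> cmod (fourier \<phi> \<xi>) = 1}"

definition log_expansion :: "(int \<Rightarrow> complex) \<Rightarrow> real \<Rightarrow> nat \<Rightarrow> real \<Rightarrow> complex \<Rightarrow> bool" where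
  "log_expansion \<phi> \<xi>0 m \<alpha> \<beta> \<longleftrightarrow>
     m \<ge> 2 \<and> \<beta> \<noteq> 0 \<and> Re \<beta> \<ge> 0 \<and> (odd m \<longrightarrow> Re \<beta> = 0) \<and>
     (\<lambda>\<xi>. Ln (fourier \<phi> (\<xi> + \<xi>0) / fourier \<phi> \<xi>0)
            - (\<i> * of_real \<alpha> * of_real \<xi> - \<beta> * of_real \<xi> ^ m))
       \<in> o[at 0](\<lambda>\<xi>. of_real \<xi> ^ m)"

(* The little-o remainder determines m, \<alpha> and \<beta>: were two expansions to differ, their
   difference would have a non-zero leading term of degree at most the smaller m.  So THE is
   justified wherever an expansion exists. *)
definition expansion_order :: "(int \<Rightarrow> complex) \<Rightarrow> real \<Rightarrow> nat" where
  "expansion_order \<phi> \<xi>0 = (THE m. \<exists>\<alpha> \<beta>. log_expansion \<phi> \<xi>0 m \<alpha> \<beta>)"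

definition expansion_drift :: "(int \<Rightarrow> complex) \<Rightarrow> real \<Rightarrow> real" where
  "expansion_drift \<phi> \<xi>0 = (THE \<alpha>. \<exists>m \<beta>. log_expansion \<phi> \<xi>0 m \<alpha> \<beta>)"

definition expansion_coeff :: "(int \<Rightarrow> complex) \<Rightarrow> real \<Rightarrow> complex" where
  "expansion_coeff \<phi> \<xi>0 = (THE \<beta>. \<exists>m \<alpha>. log_expansion \<phi> \<xi>0 m \<alpha> \<beta>)"

definition max_order :: "(int \<Rightarrow> complex) \<Rightarrow> nat" where
  "max_order \<phi> = Max (expansion_order \<phi> ` unimodular_points \<phi>)"

definition max_order_points :: "(int \<Rightarrow> complex) \<Rightarrow> real set" where
  "max_order_points \<phi> = {\<xi> \<in> unimodular_points \<phi>. expansion_order \<phi> \<xi> = max_order \<phi>}"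

(* The integrand is continuous but need not be absolutely integrable (when Re \<beta> = 0).
   The Henstock-Kurzweil integral over UNIV is the limit of the integrals over {a..b} as
   a tends to minus infinity and b to infinity independently, so for this integrand it is
   the improper Riemann integral. *)
definition attractor :: "nat \<Rightarrow> complex \<Rightarrow> real \<Rightarrow> complex" where
  "attractor m \<beta> x = of_real (1 / (2 * pi)) *
     integral UNIV (\<lambda>u::real. exp (- \<i> * of_real x * of_real u) * exp (- \<beta> * of_real u ^ m))"

end

theory Submission
  imports Defs "HOL-Complex_Analysis.Complex_Analysis"
begin

text \<open>
  By Fourier inversion, $2\pi\,\phi^{(n)}(k)$ is the integral of $\hat\phi(\xi)^n e^{-ik\xi}$ over one
  period.  Away from the finite set $\Omega$ where $|\hat\phi| = 1$ the integrand is exponentially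
  small, so only small neighbourhoods of the points of $\Omega$ matter.  Near $p \in \Omega$, of order
  $m_p$ and drift $\alpha_p$, the integrand is the number $\hat\phi(p)^n e^{-ikp}$ of modulus one times
  \[ \exp(n\Gamma(u) - iyu), \qquad \Gamma(u) = -\beta u^{m_p} + O(u^{m_p+1}), \qquad y = k - \alpha_p n. \]
  Take $k = \lfloor\alpha_q n + x n^{1/m}\rfloor$, where $m$ is the largest order.  There are three cases.

  \<^item> If $\alpha_p = \alpha_q$ and $m_p = m$, then $y$ is within $1$ of $x n^{1/m}$, and the substitution
    $u \mapsto n^{-1/m}u$ turns the integrand into $\exp(-\beta u^m - ixu)$ in the limit.  The integral
    is $2\pi n^{-1/m} H_m^\beta(x)$ up to $o(n^{-1/m})$ (\<open>resonant_asymptotics\<close>).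
  \<^item> If $\alpha_p = \alpha_q$ and $m_p < m$, the same scaling shows that the integral is
    $O(n^{-1/m_p})$ (\<open>lower_order_negligible\<close>).
  \<^item> If $\alpha_p \ne \alpha_q$, the frequency $y$ grows like $n$ and outweighs $n\Gamma'$ near $p$, so
    the integral is $O(1/n)$ (\<open>nonresonant_negligible\<close>).

  Hence the subcollection belonging to $\alpha_q$ consists of all $\xi_j$ with $\alpha_j = \alpha_q$.

  When $\Re\beta = 0$ nothing dominates the integrand and the attractor converges only conditionally,
  so the tails have to be controlled by oscillation.  A single integration by parts suffices:
  \[ e^F = (e^F/F')' + e^F F''/F'^2. \]
  It uses nothing about $F$ except $\Re F \le 0$ and the sizes of $F'$ and $F''$
  (\<open>norm_integral_exp_le\<close>).  Since $|\Gamma'|$ and $|\Gamma''|$ are comparable with $|u|^{m-1}$ and at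
  most of size $|u|^{m-2}$, the part of the integral beyond distance $M n^{-1/m}$ is
  $O(M^{-(m-1)} n^{-1/m})$, uniformly in $n$ and in bounded $x$ (\<open>wave_integral_truncate\<close>).  The exact
  monomial $-\beta u^m$ satisfies the same hypotheses on all of the line, and the same estimate yields
  the convergence of the attractor (\<open>attractor_truncate\<close>).

  The expansion at $p$ is a factorisation $\log(\hat\phi(p+z)/\hat\phi(p)) = i\alpha z + z^m k(z)$ with
  $k$ holomorphic and $k(0) \ne 0$ (\<open>analytic_phase\<close>).  It exists because the logarithm is not
  linear: otherwise $|\hat\phi|$ would be $1$ on a whole interval, while $\Omega$ is finite
  (\<open>finite_unimodular_points\<close>).
\<close>

section \<open>Exponential integrals and integration by parts\<close>

text \<open>On the closed left half plane, which is convex, the derivative of the exponential has modulus at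
  most one.\<close>

lemma norm_exp_diff_le:
  assumes "Re z \<le> 0" "Re w \<le> 0"
  shows "cmod (exp z - exp w) \<le> cmod (z - w)"
proof -
  have "cmod (exp z - exp w) \<le> 1 * cmod (z - w)"
  proof (rule field_differentiable_bound[where S = "{u. Re u \<le> 0}" and f' = exp])
    show "convex {u. Re u \<le> 0}" by (rule convex_halfspace_Re_le)
    show "(exp has_field_derivative exp u) (at u within {u. Re u \<le> 0})" for u
      by (rule DERIV_subset[OF DERIV_exp]) simp
  qed (use assms in auto)
  then show ?thesis by simp
qed

text \<open>The first-derivative test for an exponent $F$ that may have both an oscillating and a decaying part.
  The boundary terms of the integration by parts are at most $1/|F'|$ because $\Re F \le 0$, and the
  majorant $g$ leaves open whether $|F'|$ is bounded below by a power of the variable or by a constant.\<close>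

lemma norm_integral_exp_le:
  fixes F F1 F2 :: "real \<Rightarrow> complex"
  assumes "a \<le> b"
    and F: "\<And>u. u \<in> {a..b} \<Longrightarrow> (F has_vector_derivative F1 u) (at u)"
    and F1: "\<And>u. u \<in> {a..b} \<Longrightarrow> (F1 has_vector_derivative F2 u) (at u)"
    and F2: "continuous_on {a..b} F2"
    and nz: "\<And>u. u \<in> {a..b} \<Longrightarrow> F1 u \<noteq> 0"
    and re: "\<And>u. u \<in> {a..b} \<Longrightarrow> Re (F u) \<le> 0"
    and g: "\<And>u. u \<in> {a..b} \<Longrightarrow> cmod (F2 u) / (cmod (F1 u))\<^sup>2 \<le> g u"
    and gI: "(g has_integral G) {a..b}"
  shows "cmod (integral {a..b} (\<lambda>u. exp (F u))) \<le> 1 / cmod (F1 a) + 1 / cmod (F1 b) + G"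
proof -
  \<comment> \<open>The integration by parts: integrating this derivative expresses $\int e^F$ through boundary values and $\int e^F F''/F'^2$.\<close>
  have der: "((\<lambda>u. exp (F u) / F1 u) has_vector_derivative
      exp (F u) - exp (F u) * F2 u / (F1 u)\<^sup>2) (at u within {a..b})" if "u \<in> {a..b}" for u
  proof -
    have 1: "((\<lambda>u. exp (F u)) has_vector_derivative F1 u * exp (F u)) (at u)"
      using field_vector_diff_chain_at[OF F[OF that] DERIV_exp] by (simp add: o_def)
    have 2: "((\<lambda>u. inverse (F1 u)) has_vector_derivative F2 u * - (inverse (F1 u) ^ Suc (Suc 0))) (at u)"
      using field_vector_diff_chain_at[OF F1[OF that] DERIV_inverse[OF nz[OF that]]] by (simp add: o_def)
    have "((\<lambda>u. exp (F u) * inverse (F1 u)) has_vector_derivative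
        exp (F u) * (F2 u * - (inverse (F1 u) ^ Suc (Suc 0))) + F1 u * exp (F u) * inverse (F1 u)) (at u)"
      by (rule has_vector_derivative_mult[OF 1 2])
    also have "exp (F u) * (F2 u * - (inverse (F1 u) ^ Suc (Suc 0))) + F1 u * exp (F u) * inverse (F1 u)
      = exp (F u) - exp (F u) * F2 u / (F1 u)\<^sup>2"
      using nz[OF that] by (simp add: field_simps power2_eq_square)
    finally show ?thesis by (auto simp: divide_inverse intro: has_vector_derivative_at_within)
  qed
  have cF: "continuous_on {a..b} F" and cF1: "continuous_on {a..b} F1"
    using has_vector_derivative_continuous[OF F] has_vector_derivative_continuous[OF F1]
    by (auto intro!: continuous_at_imp_continuous_on)
  let ?q = "\<lambda>u. exp (F u) * F2 u / (F1 u)\<^sup>2"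
  have int1: "(\<lambda>u. exp (F u)) integrable_on {a..b}"
    by (intro integrable_continuous_real continuous_intros cF)
  have int2: "?q integrable_on {a..b}"
    by (intro integrable_continuous_real continuous_intros cF cF1 F2) (use nz in auto)
  have "((\<lambda>u. exp (F u) - ?q u) has_integral exp (F b) / F1 b - exp (F a) / F1 a) {a..b}"
    by (rule fundamental_theorem_of_calculus[OF \<open>a \<le> b\<close> der])
  then have eq: "integral {a..b} (\<lambda>u. exp (F u)) =
      exp (F b) / F1 b - exp (F a) / F1 a + integral {a..b} ?q"
    using integral_diff[OF int1 int2] by (simp add: integral_unique algebra_simps)
  have q: "cmod (?q u) \<le> g u" if "u \<in> {a..b}" for u
  proof -
    have "cmod (?q u) = exp (Re (F u)) * (cmod (F2 u) / (cmod (F1 u))\<^sup>2)"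
      by (simp add: norm_mult norm_divide norm_power)
    also have "\<dots> \<le> 1 * (cmod (F2 u) / (cmod (F1 u))\<^sup>2)"
      using re[OF that] by (intro mult_right_mono) auto
    finally show ?thesis using g[OF that] by simp
  qed
  have 3: "cmod (integral {a..b} ?q) \<le> integral {a..b} g"
    by (rule integral_norm_bound_integral[OF int2 has_integral_integrable[OF gI] q])
  have 4: "cmod (exp (F u) / F1 u) \<le> 1 / cmod (F1 u)" if "u \<in> {a..b}" for u
    using re[OF that] by (simp add: norm_divide divide_right_mono)
  have "cmod (integral {a..b} (\<lambda>u. exp (F u))) \<le>
      cmod (exp (F b) / F1 b) + cmod (exp (F a) / F1 a) + cmod (integral {a..b} ?q)"
    unfolding eq by (intro order_trans[OF norm_triangle_ineq] add_right_mono norm_triangle_ineq4)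
  also have "\<dots> \<le> 1 / cmod (F1 b) + 1 / cmod (F1 a) + G"
    using 3 4[of a] 4[of b] \<open>a \<le> b\<close> integral_unique[OF gI] by (intro add_mono) auto
  finally show ?thesis by simp
qed

section \<open>Degenerate phases\<close>

text \<open>The properties shared by the logarithm of $\hat\phi$ at a unimodular point, once its linear part is
  removed, and by the exact monomial $-\beta u^m$.  The real part is only required to be non-positive,
  so the exponentials formed with $\Gamma$ may fail to decay.  The constants $c$ and $C$ are parameters
  apart from $r$ because the monomial admits the same constants for every $r$, and it is this uniformity
  that makes the attractor converge.\<close>

locale degenerate_phase =
  fixes m :: nat and \<beta> :: complex and r c C :: real and \<Gamma> \<Gamma>1 \<Gamma>2 :: "real \<Rightarrow> complex"
  assumes m: "m \<ge> 2" and r: "r > 0" and c: "c > 0" and C: "C \<ge> 0"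
    and deriv: "\<And>u. \<bar>u\<bar> \<le> r \<Longrightarrow> (\<Gamma> has_vector_derivative \<Gamma>1 u) (at u)"
    and deriv1: "\<And>u. \<bar>u\<bar> \<le> r \<Longrightarrow> (\<Gamma>1 has_vector_derivative \<Gamma>2 u) (at u)"
    and cont2: "continuous_on {-r..r} \<Gamma>2"
    and Re_nonpos: "\<And>u. \<bar>u\<bar> \<le> r \<Longrightarrow> Re (\<Gamma> u) \<le> 0"
    and lower: "\<And>u. \<bar>u\<bar> \<le> r \<Longrightarrow> c * \<bar>u\<bar> ^ (m - 1) \<le> cmod (\<Gamma>1 u)"
    and upper1: "\<And>u. \<bar>u\<bar> \<le> r \<Longrightarrow> cmod (\<Gamma>1 u) \<le> C * \<bar>u\<bar> ^ (m - 1)"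
    and upper2: "\<And>u. \<bar>u\<bar> \<le> r \<Longrightarrow> cmod (\<Gamma>2 u) \<le> C * \<bar>u\<bar> ^ (m - 2)"
    and approx: "\<And>u. \<bar>u\<bar> \<le> r \<Longrightarrow> cmod (\<Gamma> u + \<beta> * of_real u ^ m) \<le> C * \<bar>u\<bar> ^ (m + 1)"
begin

text \<open>Near a unimodular point $p$ of drift $\alpha$, with $N = n$ and $y = k - \alpha n$, this is
  $(\hat\phi(p+u)/\hat\phi(p))^n e^{-iku}$.\<close>

abbreviation wave :: "real \<Rightarrow> real \<Rightarrow> real \<Rightarrow> complex" where
  "wave N y u \<equiv> exp (of_real N * \<Gamma> u - \<i> * of_real y * of_real u)"

lemma wave_continuous: "continuous_on {-r..r} (wave N y)"
proof -
  have "continuous_on {-r..r} \<Gamma>"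
    using has_vector_derivative_continuous[OF deriv] by (auto intro!: continuous_at_imp_continuous_on)
  then show ?thesis by (intro continuous_intros)
qed

lemma wave_integrable: "\<lbrakk>-r \<le> a; b \<le> r\<rbrakk> \<Longrightarrow> wave N y integrable_on {a..b}"
  by (intro integrable_continuous_real continuous_on_subset[OF wave_continuous]) auto

lemma norm_wave_le: "\<lbrakk>N \<ge> 0; \<bar>u\<bar> \<le> r\<rbrakk> \<Longrightarrow> cmod (wave N y u) \<le> 1"
  using Re_nonpos[of u] by (simp add: mult_nonneg_nonpos)

lemma wave_exponent_deriv:
  assumes "\<bar>u\<bar> \<le> r"
  shows "((\<lambda>u. of_real N * \<Gamma> u - \<i> * of_real y * of_real u) has_vector_derivative
      (of_real N * \<Gamma>1 u - \<i> * of_real y)) (at u)"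
    and "((\<lambda>u. of_real N * \<Gamma>1 u - \<i> * of_real y) has_vector_derivative of_real N * \<Gamma>2 u) (at u)"
  using deriv[OF assms] deriv1[OF assms] by (auto intro!: derivative_eq_intros)

text \<open>The condition $N t^m = 1$ makes $t = N^{-1/m}$ the length scale of $\exp(N\Gamma)$.  At distance
  at least $Mt$ from the origin, $N|\Gamma'|$ is at least $cM^{m-1}/t$, which is at least twice the
  frequency $|y|$.  So
  the exponent has a derivative of size at least $\frac{1}{2}Nc\,u^{m-1}$ there, and a second derivative
  at most of size $Nu^{m-2}$.  The integration by parts applies with a multiple of $u^{-m}$ as majorant.\<close>

lemma wave_tail_right:
  assumes Nt: "N * t ^ m = 1" "t > 0" and y: "\<bar>y\<bar> \<le> Y / t"
    and M: "M > 0" "2 * Y \<le> c * M ^ (m - 1)" and \<delta>: "M * t \<le> \<delta>" "\<delta> \<le> r"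
  shows "cmod (integral {M * t..\<delta>} (wave N y)) \<le> (4 / c + 4 * C / c\<^sup>2) * t / M ^ (m - 1)"
proof -
  define p where "p = m - 1"
  have p: "p \<ge> 1" "m = Suc p" "m - 2 = p - 1" using m by (auto simp: p_def)
  have N: "N > 0" using Nt by (metis zero_less_mult_pos2 zero_less_one zero_less_power)
  have Nt': "N * t ^ p = 1 / t" using Nt p by (simp add: field_simps)
  let ?L = "N * c / 2"
  have L: "?L > 0" using N c by simp
  have s: "M * t > 0" using M Nt by simp
  have low: "?L * u ^ p \<le> cmod (of_real N * \<Gamma>1 u - \<i> * of_real y)" if "u \<in> {M * t..\<delta>}" for u
  proof -
    have u: "u > 0" "\<bar>u\<bar> \<le> r" using that s \<delta> by auto
    have "\<bar>y\<bar> \<le> Y / t" by (rule y)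
    also have "\<dots> \<le> (c * M ^ p / 2) / t"
      using M(2) Nt by (intro divide_right_mono) (auto simp: p_def)
    also have "\<dots> = ?L * (M * t) ^ p"
      using arg_cong[OF Nt', of "\<lambda>z. c * M ^ p / 2 * z"] by (simp add: power_mult_distrib mult_ac)
    also have "\<dots> \<le> ?L * u ^ p"
      using that s L by (intro mult_left_mono power_mono) auto
    finally have "\<bar>y\<bar> \<le> ?L * u ^ p" .
    moreover have "N * (c * u ^ p) \<le> cmod (of_real N * \<Gamma>1 u)"
      using lower[OF u(2)] u N by (simp add: norm_mult p_def)
    moreover have "cmod (of_real N * \<Gamma>1 u) - cmod (\<i> * of_real y) \<le> cmod (of_real N * \<Gamma>1 u - \<i> * of_real y)"
      by (rule norm_triangle_ineq2)
    ultimately show ?thesis by (simp add: norm_mult)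
  qed
  let ?g = "\<lambda>u. (N * C / ?L\<^sup>2) / u ^ (p + 1)"
  have gI: "(?g has_integral (- (N * C / ?L\<^sup>2 / p) / \<delta> ^ p) - (- (N * C / ?L\<^sup>2 / p) / (M * t) ^ p)) {M * t..\<delta>}"
  proof (rule fundamental_theorem_of_calculus[OF \<delta>(1)])
    fix u assume "u \<in> {M * t..\<delta>}"
    then have u: "u > 0" using s by auto
    have "((\<lambda>u. - (N * C / ?L\<^sup>2 / p) / u ^ p) has_real_derivative
        - (- (N * C / ?L\<^sup>2 / p) * (p * u ^ (p - 1))) / (u ^ p * u ^ p)) (at u within {M * t..\<delta>})"
      using u N c by (auto intro!: derivative_eq_intros)
    also have "- (- (N * C / ?L\<^sup>2 / p) * (p * u ^ (p - 1))) / (u ^ p * u ^ p) = ?g u"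
    proof -
      have "u ^ p = u ^ (p - 1) * u" using p(1) by (metis power_minus_mult zero_less_one order_less_le_trans)
      then show ?thesis using u p(1) N c by (simp add: field_simps)
    qed
    finally show "((\<lambda>u. - (N * C / ?L\<^sup>2 / p) / u ^ p) has_vector_derivative ?g u) (at u within {M * t..\<delta>})"
      by (simp add: has_real_derivative_iff_has_vector_derivative)
  qed
  have g: "cmod (of_real N * \<Gamma>2 u) / (cmod (of_real N * \<Gamma>1 u - \<i> * of_real y))\<^sup>2 \<le> ?g u"
    if "u \<in> {M * t..\<delta>}" for u
  proof -
    have u: "u > 0" "\<bar>u\<bar> \<le> r" using that s \<delta> by auto
    have "cmod (of_real N * \<Gamma>2 u) / (cmod (of_real N * \<Gamma>1 u - \<i> * of_real y))\<^sup>2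
        \<le> (N * (C * u ^ (p - 1))) / (?L * u ^ p)\<^sup>2"
    proof (rule frac_le)
      show "cmod (of_real N * \<Gamma>2 u) \<le> N * (C * u ^ (p - 1))"
        using upper2[OF u(2)] u N p by (simp add: norm_mult)
      show "(?L * u ^ p)\<^sup>2 \<le> (cmod (of_real N * \<Gamma>1 u - \<i> * of_real y))\<^sup>2"
        using low[OF that] L u by (intro power_mono) auto
    qed (use L u N C in auto)
    also have "\<dots> = ?g u"
    proof -
      have "u ^ p = u ^ (p - 1) * u" using p(1) by (metis power_minus_mult zero_less_one order_less_le_trans)
      then show ?thesis using u p(1) L by (simp add: field_simps power2_eq_square)
    qed
    finally show ?thesis .
  qed
  have nz: "of_real N * \<Gamma>1 u - \<i> * of_real y \<noteq> 0" if "u \<in> {M * t..\<delta>}" for u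
  proof -
    have "0 < ?L * u ^ p" using that s L by (intro mult_pos_pos) auto
    with low[OF that] show ?thesis by auto
  qed
  have end_pt: "1 / cmod (of_real N * \<Gamma>1 u - \<i> * of_real y) \<le> 1 / (?L * (M * t) ^ p)"
    if "u \<in> {M * t..\<delta>}" for u
  proof (rule divide_left_mono)
    show "?L * (M * t) ^ p \<le> cmod (of_real N * \<Gamma>1 u - \<i> * of_real y)"
      using low[OF that] that s L by (intro order_trans[OF _ low[OF that]] mult_left_mono power_mono) auto
  qed (use nz[OF that] s L in auto)
  have cont: "continuous_on {M * t..\<delta>} (\<lambda>u. of_real N * \<Gamma>2 u)"
    using \<delta> s by (intro continuous_intros continuous_on_subset[OF cont2]) auto
  have "cmod (integral {M * t..\<delta>} (wave N y)) \<le>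
      1 / cmod (of_real N * \<Gamma>1 (M * t) - \<i> * of_real y) + 1 / cmod (of_real N * \<Gamma>1 \<delta> - \<i> * of_real y)
      + ((- (N * C / ?L\<^sup>2 / p) / \<delta> ^ p) - (- (N * C / ?L\<^sup>2 / p) / (M * t) ^ p))"
  proof (rule norm_integral_exp_le[OF \<delta>(1) _ _ cont nz _ g gI])
    fix u assume "u \<in> {M * t..\<delta>}"
    then have u: "\<bar>u\<bar> \<le> r" using s \<delta> by auto
    show "((\<lambda>u. of_real N * \<Gamma> u - \<i> * of_real y * of_real u) has_vector_derivative
      (of_real N * \<Gamma>1 u - \<i> * of_real y)) (at u)"
    "((\<lambda>u. of_real N * \<Gamma>1 u - \<i> * of_real y) has_vector_derivative of_real N * \<Gamma>2 u) (at u)"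
      by (rule wave_exponent_deriv[OF u])+
    show "Re (of_real N * \<Gamma> u - \<i> * of_real y * of_real u) \<le> 0"
      using Re_nonpos[OF u] N by (simp add: mult_nonneg_nonpos)
  qed
  also have "\<dots> \<le> 1 / (?L * (M * t) ^ p) + 1 / (?L * (M * t) ^ p) + (N * C / ?L\<^sup>2) / (M * t) ^ p"
  proof (intro add_mono end_pt)
    have "0 \<le> (N * C / ?L\<^sup>2 / p) / \<delta> ^ p" using N C s \<delta> by (intro divide_nonneg_nonneg) auto
    moreover have "(N * C / ?L\<^sup>2 / p) / (M * t) ^ p \<le> (N * C / ?L\<^sup>2) / (M * t) ^ p"
    proof (rule divide_right_mono)
      show "N * C / ?L\<^sup>2 / p \<le> N * C / ?L\<^sup>2"
        using divide_left_mono[of 1 "real p" "N * C / ?L\<^sup>2"] p(1) N C by simp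
    qed (use s in auto)
    ultimately show "- (N * C / ?L\<^sup>2 / p) / \<delta> ^ p - - (N * C / ?L\<^sup>2 / p) / (M * t) ^ p \<le> (N * C / ?L\<^sup>2) / (M * t) ^ p"
      by simp
  qed (use \<delta> in auto)
  also have "\<dots> = (4 / c + 4 * C / c\<^sup>2) / (N * (M * t) ^ p)"
  proof -
    have "1 / (?L * A) + 1 / (?L * A) + (N * C / ?L\<^sup>2) / A = (4 / c + 4 * C / c\<^sup>2) / (N * A)" if "A > 0" for A
      using N c that by (simp add: field_simps power2_eq_square)
    from this[of "(M * t) ^ p"] show ?thesis using s by (simp only: zero_less_power simp_thms True_implies_equals)
  qed
  also have "N * (M * t) ^ p = M ^ p / t"
    using arg_cong[OF Nt', of "\<lambda>z. M ^ p * z"] by (simp add: power_mult_distrib mult_ac)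
  finally show ?thesis by (simp add: p_def)
qed

text \<open>The reflection $u \mapsto -u$ carries the left tail to the right one.\<close>

lemma reflected:
  "degenerate_phase m ((- 1) ^ m * \<beta>) r c C (\<lambda>u. \<Gamma> (- u)) (\<lambda>u. - \<Gamma>1 (- u)) (\<lambda>u. \<Gamma>2 (- u))"
proof (unfold_locales)
  have neg: "((\<lambda>u::real. - u) has_vector_derivative - 1) (at u)" for u
    by (auto intro!: derivative_eq_intros)
  show "((\<lambda>u. \<Gamma> (- u)) has_vector_derivative - \<Gamma>1 (- u)) (at u)" if "\<bar>u\<bar> \<le> r" for u
    using vector_diff_chain_at[OF neg deriv[of "- u"]] that by (simp add: o_def)
  show "((\<lambda>u. - \<Gamma>1 (- u)) has_vector_derivative \<Gamma>2 (- u)) (at u)" if "\<bar>u\<bar> \<le> r" for u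
    using has_vector_derivative_minus[OF vector_diff_chain_at[OF neg deriv1[of "- u"]]] that
    by (simp add: o_def)
  show "continuous_on {-r..r} (\<lambda>u. \<Gamma>2 (- u))"
    by (rule continuous_on_compose2[OF cont2]) (auto intro!: continuous_intros)
  show "cmod (\<Gamma> (- u) + (- 1) ^ m * \<beta> * of_real u ^ m) \<le> C * \<bar>u\<bar> ^ (m + 1)" if "\<bar>u\<bar> \<le> r" for u
  proof -
    have "(of_real (- u) :: complex) ^ m = (- 1) ^ m * of_real u ^ m"
      by (metis mult_minus1 of_real_minus power_mult_distrib)
    then show ?thesis using approx[of "- u"] that by (simp add: mult_ac)
  qed
  show "c * \<bar>u\<bar> ^ (m - 1) \<le> cmod (- \<Gamma>1 (- u))" "cmod (- \<Gamma>1 (- u)) \<le> C * \<bar>u\<bar> ^ (m - 1)"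
    "cmod (\<Gamma>2 (- u)) \<le> C * \<bar>u\<bar> ^ (m - 2)" if "\<bar>u\<bar> \<le> r" for u
    using lower[of "- u"] upper1[of "- u"] upper2[of "- u"] that by auto
qed (use m r c C Re_nonpos in auto)

lemma wave_tail_left:
  assumes "N * t ^ m = 1" "t > 0" and "\<bar>y\<bar> \<le> Y / t"
    and "M > 0" "2 * Y \<le> c * M ^ (m - 1)" and "M * t \<le> \<delta>" "\<delta> \<le> r"
  shows "cmod (integral {-\<delta>..- (M * t)} (wave N y)) \<le> (4 / c + 4 * C / c\<^sup>2) * t / M ^ (m - 1)"
proof -
  interpret R: degenerate_phase m "(- 1) ^ m * \<beta>" r c C "\<lambda>u. \<Gamma> (- u)" "\<lambda>u. - \<Gamma>1 (- u)" "\<lambda>u. \<Gamma>2 (- u)"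
    by (rule reflected)
  have "integral {-\<delta>..- (M * t)} (wave N y) = integral {M * t..\<delta>} (R.wave N (- y))"
    using Henstock_Kurzweil_Integration.integral_reflect_real[of \<delta> "M * t" "R.wave N (- y)"] by simp
  then show ?thesis using R.wave_tail_right[of N t "- y" Y M \<delta>] assms by simp
qed

lemma wave_integral_truncate:
  assumes Nt: "N * t ^ m = 1" "t > 0" and y: "\<bar>y\<bar> \<le> Y / t"
    and M: "M > 0" "2 * Y \<le> c * M ^ (m - 1)"
    and ab: "a \<le> - (M * t)" "M * t \<le> b" "- r \<le> a" "b \<le> r"
  shows "cmod (integral {a..b} (wave N y) - integral {- (M * t)..M * t} (wave N y))
    \<le> 2 * (4 / c + 4 * C / c\<^sup>2) * t / M ^ (m - 1)"
proof -
  have s: "M * t > 0" using M Nt by simp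
  have "integral {a..b} (wave N y) = integral {a..- (M * t)} (wave N y)
      + integral {- (M * t)..M * t} (wave N y) + integral {M * t..b} (wave N y)"
  proof -
    have "integral {a..- (M * t)} (wave N y) + integral {- (M * t)..b} (wave N y) = integral {a..b} (wave N y)"
      by (rule Henstock_Kurzweil_Integration.integral_combine) (use ab s wave_integrable in auto)
    moreover have "integral {- (M * t)..M * t} (wave N y) + integral {M * t..b} (wave N y)
        = integral {- (M * t)..b} (wave N y)"
      by (rule Henstock_Kurzweil_Integration.integral_combine) (use ab s wave_integrable in auto)
    ultimately show ?thesis by (simp only: add.assoc)
  qed
  then have "cmod (integral {a..b} (wave N y) - integral {- (M * t)..M * t} (wave N y))
      \<le> cmod (integral {a..- (M * t)} (wave N y)) + cmod (integral {M * t..b} (wave N y))"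
    by (simp add: norm_triangle_ineq)
  also have "\<dots> \<le> (4 / c + 4 * C / c\<^sup>2) * t / M ^ (m - 1) + (4 / c + 4 * C / c\<^sup>2) * t / M ^ (m - 1)"
    using wave_tail_right[OF Nt y M ab(2,4)] wave_tail_left[OF Nt y M, of "- a"] ab by (intro add_mono) auto
  finally show ?thesis by (simp only: mult_2 distrib_right add_divide_distrib)
qed

lemma wave_integral_bound:
  assumes Nt: "N * t ^ m = 1" "t > 0" and y: "\<bar>y\<bar> \<le> Y / t"
    and M: "M > 0" "2 * Y \<le> c * M ^ (m - 1)" and \<delta>: "M * t \<le> \<delta>" "\<delta> \<le> r"
  shows "cmod (integral {-\<delta>..\<delta>} (wave N y)) \<le> (2 * M + 2 * (4 / c + 4 * C / c\<^sup>2) / M ^ (m - 1)) * t"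
proof -
  have s: "M * t > 0" using M Nt by simp
  have N: "N > 0" using Nt by (metis zero_less_mult_pos2 zero_less_one zero_less_power)
  have int: "wave N y integrable_on {- (M * t)..M * t}" using \<delta> by (intro wave_integrable) auto
  have "cmod (integral {- (M * t)..M * t} (wave N y)) \<le> integral {- (M * t)..M * t} (\<lambda>_. 1)"
    using N \<delta> by (intro integral_norm_bound_integral[OF int]) (auto intro!: norm_wave_le simp del: norm_exp_eq_Re)
  also have "\<dots> = 2 * M * t" using s by simp
  finally have 1: "cmod (integral {- (M * t)..M * t} (wave N y)) \<le> 2 * M * t" .
  have 2: "cmod (integral {-\<delta>..\<delta>} (wave N y) - integral {- (M * t)..M * t} (wave N y))
    \<le> 2 * (4 / c + 4 * C / c\<^sup>2) * t / M ^ (m - 1)"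
    using \<delta> by (intro wave_integral_truncate[OF Nt y M]) auto
  have "cmod (integral {-\<delta>..\<delta>} (wave N y)) \<le> 2 * M * t + 2 * (4 / c + 4 * C / c\<^sup>2) * t / M ^ (m - 1)"
    by (rule order_trans[OF norm_triangle_sub add_mono[OF 1 2]])
  also have "\<dots> = (2 * M + 2 * (4 / c + 4 * C / c\<^sup>2) / M ^ (m - 1)) * t"
    by (simp add: distrib_right)
  finally show ?thesis .
qed

text \<open>Dividing $\Re\Gamma(u) \le 0$ by $|u|^m$ and letting $u$ tend to $0$ from the right gives the inequality.
  For odd $m$ the limit from the left gives the opposite one.\<close>

lemma Re_coeff: "Re \<beta> \<ge> 0" "odd m \<Longrightarrow> Re \<beta> = 0"
proof -
  have key: "Re \<beta> * u ^ m \<ge> - (C * \<bar>u\<bar> ^ (m + 1))" if "\<bar>u\<bar> \<le> r" for u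
  proof -
    have "Re (\<Gamma> u + \<beta> * of_real u ^ m) \<ge> - cmod (\<Gamma> u + \<beta> * of_real u ^ m)"
      using abs_Re_le_cmod[of "\<Gamma> u + \<beta> * of_real u ^ m"] by linarith
    then show ?thesis using approx[OF that] Re_nonpos[OF that] by (simp flip: of_real_power)
  qed
  have lim: "((\<lambda>u::real. - (C * u)) \<longlongrightarrow> - (C * 0)) (at_right 0)"
    by (intro tendsto_intros)
  have ev: "eventually (\<lambda>u. 0 < u \<and> u < r) (at_right 0)"
    using eventually_at_right_real[OF r] by simp
  have "eventually (\<lambda>u. - (C * u) \<le> Re \<beta>) (at_right 0)"
    using ev
  proof eventually_elim
    case (elim u)
    then have "u ^ m * (- (C * u)) \<le> u ^ m * Re \<beta>" using key[of u] by (simp add: mult_ac)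
    then show ?case using elim by (auto intro: mult_left_le_imp_le[of "u ^ m"])
  qed
  from tendsto_upperbound[OF lim this] show 1: "Re \<beta> \<ge> 0" by simp
  show "Re \<beta> = 0" if "odd m"
  proof -
    have "eventually (\<lambda>u. - (C * u) \<le> - Re \<beta>) (at_right 0)"
      using ev
    proof eventually_elim
      case (elim u)
      have "u ^ m * (- (C * u)) = - (C * \<bar>- u\<bar> ^ (m + 1))" using elim by simp
      also have "\<dots> \<le> Re \<beta> * (- u) ^ m" using key[of "- u"] elim by simp
      also have "\<dots> = u ^ m * (- Re \<beta>)" using that by simp
      finally have "u ^ m * (- (C * u)) \<le> u ^ m * (- Re \<beta>)" .
      then show ?case using elim by (auto intro: mult_left_le_imp_le[of "u ^ m"])
    qed
    from tendsto_upperbound[OF lim this] have "0 \<le> - Re \<beta>" by simp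
    with 1 show ?thesis by simp
  qed
qed

text \<open>On the rescaled window of fixed width $2M$ the exponents differ by $O(t)$: the phase contributes
  $N\,O((tM)^{m+1}) = O(tM^{m+1})$, and the frequency $yt$ is within $t$ of $x$.\<close>

lemma wave_integral_centre:
  assumes Nt: "N * t ^ m = 1" "t > 0" and M: "M > 0" "M * t \<le> r"
    and yx: "\<bar>y * t - x\<bar> \<le> t"
  shows "cmod (integral {- (M * t)..M * t} (wave N y) / t
      - integral {-M..M} (\<lambda>u. exp (- \<beta> * of_real u ^ m - \<i> * of_real x * of_real u)))
    \<le> 2 * M * t * (C * M ^ (m + 1) + M)"
proof -
  let ?P = "\<lambda>u. exp (- \<beta> * of_real u ^ m - \<i> * of_real x * of_real u)"
  have s: "M * t > 0" using M Nt by simp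
  have N: "N > 0" using Nt by (metis zero_less_mult_pos2 zero_less_one zero_less_power)
  have Mr: "\<bar>t * u\<bar> \<le> r" if "\<bar>u\<bar> \<le> M" for u
  proof -
    have "t * \<bar>u\<bar> \<le> t * M" using that Nt by (intro mult_left_mono) auto
    then have "t * \<bar>u\<bar> \<le> r" using M by (simp add: mult.commute)
    then show ?thesis using Nt by (simp add: abs_mult)
  qed
  have int: "wave N y integrable_on {- (M * t)..M * t}" using M by (intro wave_integrable) auto
  have "((\<lambda>u. wave N y (t * u)) has_integral (1 / \<bar>t\<bar>) *\<^sub>R integral {- (M * t)..M * t} (wave N y))
      ((\<lambda>u. u / t) ` {- (M * t)..M * t})"
    using Nt by (intro has_integral_stretch_real integrable_integral int) auto
  also have "(\<lambda>u. u / t) ` {- (M * t)..M * t} = {-M..M}"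
    using Nt by simp
  also have "(1 / \<bar>t\<bar>) *\<^sub>R integral {- (M * t)..M * t} (wave N y) = integral {- (M * t)..M * t} (wave N y) / t"
    using Nt by (simp add: scaleR_conv_of_real field_simps)
  finally have 1: "((\<lambda>u. wave N y (t * u)) has_integral integral {- (M * t)..M * t} (wave N y) / t) {-M..M}" .
  have 2: "(?P has_integral integral {-M..M} ?P) {-M..M}"
    by (intro integrable_integral integrable_continuous_real continuous_intros)
  have "cmod (integral {- (M * t)..M * t} (wave N y) / t - integral {-M..M} ?P)
      \<le> t * (C * M ^ (m + 1) + M) * measure lborel {-M..M}"
  proof (rule has_integral_bound_real[OF _ finite.emptyI has_integral_diff[OF 1 2]])
    show "0 \<le> t * (C * M ^ (m + 1) + M)" using Nt C M by simp
    fix u assume u: "u \<in> {-M..M} - {}"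
    then have u': "\<bar>u\<bar> \<le> M" by auto
    have "cmod (wave N y (t * u) - ?P u) \<le> cmod ((of_real N * \<Gamma> (t * u) - \<i> * of_real y * of_real (t * u))
        - (- \<beta> * of_real u ^ m - \<i> * of_real x * of_real u))"
    proof (rule norm_exp_diff_le)
      show "Re (of_real N * \<Gamma> (t * u) - \<i> * of_real y * of_real (t * u)) \<le> 0"
        using Re_nonpos[OF Mr[OF u']] N by (simp add: mult_nonneg_nonpos)
      have "Re \<beta> * u ^ m \<ge> 0"
        using Re_coeff by (cases "even m") (auto simp: zero_le_even_power)
      then show "Re (- \<beta> * of_real u ^ m - \<i> * of_real x * of_real u) \<le> 0"
        by (simp flip: of_real_power)
    qed
    also have "(of_real N * \<Gamma> (t * u) - \<i> * of_real y * of_real (t * u))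
        - (- \<beta> * of_real u ^ m - \<i> * of_real x * of_real u)
        = of_real N * (\<Gamma> (t * u) + \<beta> * of_real (t * u) ^ m) - \<i> * of_real (y * t - x) * of_real u"
    proof -
      have "of_real N * (\<beta> * of_real (t * u) ^ m) = of_real (N * t ^ m) * (\<beta> * of_real u ^ m)"
        by (simp add: power_mult_distrib)
      then have "of_real N * (\<beta> * of_real (t * u) ^ m) = \<beta> * of_real u ^ m" using Nt by simp
      then show ?thesis by (simp add: algebra_simps)
    qed
    also have "cmod \<dots> \<le> cmod (of_real N * (\<Gamma> (t * u) + \<beta> * of_real (t * u) ^ m))
        + cmod (\<i> * of_real (y * t - x) * of_real u)"
      by (rule norm_triangle_ineq4)
    also have "\<dots> \<le> N * (C * \<bar>t * u\<bar> ^ (m + 1)) + t * M"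
      using approx[OF Mr[OF u']] N yx u' Nt by (intro add_mono) (auto simp: norm_mult intro!: mult_mono simp del: of_real_mult of_real_diff)
    also have "N * (C * \<bar>t * u\<bar> ^ (m + 1)) = C * t * (N * t ^ m) * \<bar>u\<bar> ^ (m + 1)"
      using Nt(2) by (simp add: abs_mult power_mult_distrib mult_ac)
    also have "\<dots> \<le> C * t * M ^ (m + 1)"
      using Nt C u' by (auto intro!: mult_left_mono mult_nonneg_nonneg mult_mono power_mono)
    finally show "cmod (wave N y (t * u) - ?P u) \<le> t * (C * M ^ (m + 1) + M)"
      by (simp add: algebra_simps)
  qed
  also have "measure lborel {-M..M} = 2 * M" using M by simp
  finally show ?thesis by (simp add: mult_ac)
qed

text \<open>A frequency proportional to $N$ dominates $N\Gamma'$ on a neighbourhood chosen independently of $N$,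
  so the exponent has no stationary point there and its derivative is of size $N$ throughout.\<close>

lemma wave_integral_nonresonant:
  assumes N: "N > 0" and g: "g > 0" "g * N \<le> \<bar>y\<bar>" and \<delta>: "0 < \<delta>" "\<delta> \<le> r" "\<delta> \<le> 1" "C * \<delta> \<le> g / 2"
  shows "cmod (integral {-\<delta>..\<delta>} (wave N y)) \<le> (4 / g + 8 * C / g\<^sup>2) / N"
proof -
  let ?L = "g * N / 2"
  have L: "?L > 0" using N g by simp
  have low: "?L \<le> cmod (of_real N * \<Gamma>1 u - \<i> * of_real y)" if "u \<in> {-\<delta>..\<delta>}" for u
  proof -
    have u: "\<bar>u\<bar> \<le> \<delta>" "\<bar>u\<bar> \<le> r" using that \<delta> by auto
    have "cmod (\<Gamma>1 u) \<le> C * \<bar>u\<bar> ^ (m - 1)" by (rule upper1[OF u(2)])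
    also have "\<dots> \<le> C * \<delta> ^ 1"
      using u(1) C \<delta> m
      by (intro mult_left_mono order_trans[OF power_mono power_decreasing]) auto
    also have "\<dots> \<le> g / 2" using \<delta> by simp
    finally have "N * cmod (\<Gamma>1 u) \<le> g * N / 2" using N by (simp add: mult.commute)
    moreover have "cmod (\<i> * of_real y) - cmod (of_real N * \<Gamma>1 u) \<le> cmod (\<i> * of_real y - of_real N * \<Gamma>1 u)"
      by (rule norm_triangle_ineq2)
    moreover have "cmod (\<i> * of_real y - of_real N * \<Gamma>1 u) = cmod (of_real N * \<Gamma>1 u - \<i> * of_real y)"
      by (rule norm_minus_commute)
    moreover have "cmod (\<i> * of_real y) = \<bar>y\<bar>" "cmod (of_real N * \<Gamma>1 u) = N * cmod (\<Gamma>1 u)"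
      using N by (simp_all add: norm_mult)
    ultimately show ?thesis using g(2) by linarith
  qed
  have cont: "continuous_on {-\<delta>..\<delta>} (\<lambda>u. of_real N * \<Gamma>2 u)"
    using \<delta> by (intro continuous_intros continuous_on_subset[OF cont2]) auto
  have gI: "((\<lambda>_. N * C / ?L\<^sup>2) has_integral measure lborel {-\<delta>..\<delta>} *\<^sub>R (N * C / ?L\<^sup>2)) {-\<delta>..\<delta>}"
    by (rule has_integral_const_real)
  have "cmod (integral {-\<delta>..\<delta>} (wave N y)) \<le>
      1 / cmod (of_real N * \<Gamma>1 (-\<delta>) - \<i> * of_real y) + 1 / cmod (of_real N * \<Gamma>1 \<delta> - \<i> * of_real y)
      + measure lborel {-\<delta>..\<delta>} *\<^sub>R (N * C / ?L\<^sup>2)"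
  proof (rule norm_integral_exp_le[OF _ _ _ cont _ _ _ gI])
    fix u assume u: "u \<in> {-\<delta>..\<delta>}"
    then have ur: "\<bar>u\<bar> \<le> r" "\<bar>u\<bar> \<le> \<delta>" using \<delta> by auto
    show "((\<lambda>u. of_real N * \<Gamma> u - \<i> * of_real y * of_real u) has_vector_derivative
      (of_real N * \<Gamma>1 u - \<i> * of_real y)) (at u)"
    "((\<lambda>u. of_real N * \<Gamma>1 u - \<i> * of_real y) has_vector_derivative of_real N * \<Gamma>2 u) (at u)"
      by (rule wave_exponent_deriv[OF ur(1)])+
    show "Re (of_real N * \<Gamma> u - \<i> * of_real y * of_real u) \<le> 0"
      using Re_nonpos[OF ur(1)] N by (simp add: mult_nonneg_nonpos)
    show "of_real N * \<Gamma>1 u - \<i> * of_real y \<noteq> 0" using low[OF u] L by auto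
    have "cmod (\<Gamma>2 u) \<le> C * \<bar>u\<bar> ^ (m - 2)" by (rule upper2[OF ur(1)])
    also have "\<dots> \<le> C * 1" using C ur \<delta> by (intro mult_left_mono power_le_one) auto
    finally have "cmod (\<Gamma>2 u) \<le> C" by simp
    then show "cmod (of_real N * \<Gamma>2 u) / (cmod (of_real N * \<Gamma>1 u - \<i> * of_real y))\<^sup>2 \<le> N * C / ?L\<^sup>2"
      using low[OF u] L N C by (intro frac_le power_mono) (auto simp: norm_mult)
  qed (use \<delta> in auto)
  also have "\<dots> \<le> 1 / ?L + 1 / ?L + 2 * (N * C / ?L\<^sup>2)"
  proof (intro add_mono divide_left_mono low)
    have "0 \<le> N * C / ?L\<^sup>2" using N C by simp
    then show "measure lborel {-\<delta>..\<delta>} *\<^sub>R (N * C / ?L\<^sup>2) \<le> 2 * (N * C / ?L\<^sup>2)"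
      using \<delta> mult_right_mono[of "2 * \<delta>" 2 "N * C / ?L\<^sup>2"] by simp
  next
    show "0 < cmod (of_real N * \<Gamma>1 (-\<delta>) - \<i> * of_real y) * ?L"
      using low[of "-\<delta>"] L \<delta> by (intro mult_pos_pos) auto
    show "0 < cmod (of_real N * \<Gamma>1 \<delta> - \<i> * of_real y) * ?L"
      using low[of \<delta>] L \<delta> by (intro mult_pos_pos) auto
  qed (use L \<delta> in auto)
  also have "\<dots> = (4 / g + 8 * C / g\<^sup>2) / N"
    using N g by (simp add: field_simps power2_eq_square)
  finally show ?thesis .
qed

end

section \<open>Convergence of the attractor\<close>

lemma monomial_phase:
  assumes "m \<ge> 2" "\<beta> \<noteq> 0" "Re \<beta> \<ge> 0" "odd m \<Longrightarrow> Re \<beta> = 0" "r > 0"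
  shows "degenerate_phase m \<beta> r (m * cmod \<beta>) (real m * real m * cmod \<beta>) (\<lambda>u. - \<beta> * of_real u ^ m)
    (\<lambda>u. - \<beta> * of_nat m * of_real u ^ (m - 1)) (\<lambda>u. - \<beta> * of_nat m * of_nat (m - 1) * of_real u ^ (m - 2))"
proof (unfold_locales)
  have pw: "((\<lambda>u::real. complex_of_real u ^ k) has_vector_derivative of_nat k * of_real u ^ (k - 1)) (at u)" for u k
  proof -
    have "((\<lambda>z::complex. z ^ k) has_field_derivative of_nat k * of_real u ^ (k - 1)) (at (of_real u))"
      by (auto intro!: derivative_eq_intros)
    then show ?thesis by (rule has_vector_derivative_real_field)
  qed
  show "((\<lambda>u. - \<beta> * of_real u ^ m) has_vector_derivative - \<beta> * of_nat m * of_real u ^ (m - 1)) (at u)" for u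
    using has_vector_derivative_mult_right[OF pw[of m u], of "- \<beta>"] by (simp add: mult_ac)
  show "((\<lambda>u. - \<beta> * of_nat m * of_real u ^ (m - 1)) has_vector_derivative
      - \<beta> * of_nat m * of_nat (m - 1) * of_real u ^ (m - 2)) (at u)" for u
    using has_vector_derivative_mult_right[OF pw[of "m - 1" u], of "- \<beta> * of_nat m"]
    by (simp add: mult_ac numeral_2_eq_2)
  show "continuous_on {-r..r} (\<lambda>u. - \<beta> * of_nat m * of_nat (m - 1) * of_real u ^ (m - 2))"
    by (intro continuous_intros)
  show "Re (- \<beta> * of_real u ^ m) \<le> 0" for u
    using assms by (cases "even m") (auto simp: zero_le_even_power simp flip: of_real_power)
  have mm: "real m \<le> real m * real m" using assms by (simp add: mult_le_cancel_left1)
  show "cmod (- \<beta> * of_nat m * of_real u ^ (m - 1)) \<le> real m * real m * cmod \<beta> * \<bar>u\<bar> ^ (m - 1)" for u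
    using mult_right_mono[OF mm, of "cmod \<beta> * \<bar>u\<bar> ^ (m - 1)"] by (simp add: norm_mult norm_power mult_ac)
  have mm': "real m * real (m - 1) \<le> real m * real m" by (intro mult_left_mono) auto
  show "cmod (- \<beta> * of_nat m * of_nat (m - 1) * of_real u ^ (m - 2)) \<le> real m * real m * cmod \<beta> * \<bar>u\<bar> ^ (m - 2)" for u
    using mult_right_mono[OF mm', of "cmod \<beta> * \<bar>u\<bar> ^ (m - 2)"] by (simp add: norm_mult norm_power mult_ac)
qed (use assms in \<open>auto simp: norm_mult norm_power\<close>)

text \<open>The improper integral over the line exists and is approximated by symmetric truncations, with an
  error that is uniform for bounded $x$.  Since the monomial is a degenerate phase on every interval,
  the tail estimate with $N = t = 1$ bounds the difference between two truncations, which gives both a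
  Cauchy sequence and the rate.\<close>

lemma attractor_truncate:
  assumes "m \<ge> 2" "\<beta> \<noteq> 0" "Re \<beta> \<ge> 0" "odd m \<Longrightarrow> Re \<beta> = 0"
    and X: "\<bar>x\<bar> \<le> X" and M: "M > 0" "2 * X \<le> m * cmod \<beta> * M ^ (m - 1)"
  shows "cmod (integral {-M..M} (\<lambda>u. exp (- \<beta> * of_real u ^ m - \<i> * of_real x * of_real u))
      - of_real (2 * pi) * attractor m \<beta> x)
    \<le> 2 * (4 / (m * cmod \<beta>) + 4 * (real m * real m * cmod \<beta>) / (m * cmod \<beta>)\<^sup>2) / M ^ (m - 1)"
proof -
  let ?P = "\<lambda>u. exp (- \<beta> * of_real u ^ m - \<i> * of_real x * of_real u)"
  define K where "K = 2 * (4 / (m * cmod \<beta>) + 4 * (real m * real m * cmod \<beta>) / (m * cmod \<beta>)\<^sup>2)"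
  have K: "K > 0"
    unfolding K_def using assms(1,2) by (intro mult_pos_pos add_pos_nonneg) auto
  \<comment> \<open>The bound does not depend on $a$ and $b$, so it controls all larger intervals at once.\<close>
  have trunc: "cmod (integral {a..b} ?P - integral {-L..L} ?P) \<le> K / L ^ (m - 1)"
    if L: "M \<le> L" "a \<le> -L" "L \<le> b" for a b L
  proof -
    interpret degenerate_phase m \<beta> "\<bar>a\<bar> + \<bar>b\<bar> + 1" "m * cmod \<beta>" "real m * real m * cmod \<beta>" "\<lambda>u. - \<beta> * of_real u ^ m"
      "\<lambda>u. - \<beta> * of_nat m * of_real u ^ (m - 1)" "\<lambda>u. - \<beta> * of_nat m * of_nat (m - 1) * of_real u ^ (m - 2)"
      using monomial_phase[OF assms(1-4), of "\<bar>a\<bar> + \<bar>b\<bar> + 1"] by simp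
    have "m * cmod \<beta> * M ^ (m - 1) \<le> m * cmod \<beta> * L ^ (m - 1)"
      using L M by (intro mult_left_mono power_mono) auto
    then show ?thesis
      using wave_integral_truncate[of 1 1 x X L a b] L M X unfolding K_def by simp
  qed
  have Cauchy: "Cauchy (\<lambda>j::nat. integral {-real j..real j} ?P)"
  proof (rule metric_CauchyI)
    fix e :: real assume e: "e > 0"
    obtain J :: nat where J: "real J > max (max M 1) (2 * K / e)" using reals_Archimedean2 by blast
    have lt: "dist (integral {-real j..real j} ?P) (integral {-real J..real J} ?P) < e / 2" if "j \<ge> J" for j
    proof -
      have "real J \<le> real J ^ (m - 1)" using J assms(1) by (intro self_le_power) auto
      then have "K / real J ^ (m - 1) \<le> K / real J" using J M K by (intro divide_left_mono) auto
      also have "\<dots> < e / 2" using J e M by (auto simp: field_simps)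
      finally have "K / real J ^ (m - 1) < e / 2" .
      moreover have "cmod (integral {-real j..real j} ?P - integral {-real J..real J} ?P) \<le> K / real J ^ (m - 1)"
        by (rule trunc) (use J that in auto)
      ultimately show ?thesis unfolding dist_norm by linarith
    qed
    show "\<exists>J. \<forall>i\<ge>J. \<forall>j\<ge>J. dist (integral {-real i..real i} ?P) (integral {-real j..real j} ?P) < e"
      using dist_triangle_half_l lt by blast
  qed
  then obtain I where I: "(\<lambda>j::nat. integral {-real j..real j} ?P) \<longlonglongrightarrow> I"
    by (auto dest!: Cauchy_convergent simp: convergent_def)
  have close: "cmod (I - integral {-L..L} ?P) \<le> K / L ^ (m - 1)" if L: "M \<le> L" for L
  proof (rule tendsto_upperbound)
    show "(\<lambda>j::nat. cmod (integral {-real j..real j} ?P - integral {-L..L} ?P))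
        \<longlonglongrightarrow> cmod (I - integral {-L..L} ?P)"
      by (intro tendsto_intros I)
    show "\<forall>\<^sub>F j in sequentially. cmod (integral {-real j..real j} ?P - integral {-L..L} ?P) \<le> K / L ^ (m - 1)"
      using eventually_ge_at_top[of "nat \<lceil>L\<rceil>"]
    proof eventually_elim
      case (elim j)
      then have "L \<le> real j" by linarith
      then show ?case by (intro trunc L) auto
    qed
  qed simp
  have "(?P has_integral I) UNIV"
    unfolding has_integral'[of _ _ UNIV]
  proof (intro allI impI)
    fix e :: real assume e: "e > 0"
    define L where "L = max M 1 + 2 * K / e"
    have L: "M \<le> L" "L \<ge> 1" "L > 0" and KL: "2 * K < e * L"
    proof -
      have "0 < 2 * K / e" using K e by simp
      then show "M \<le> L" "L \<ge> 1" "L > 0" unfolding L_def by linarith+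
      have "2 * K < e * max M 1 + 2 * K" using e by simp
      also have "\<dots> = e * L" using e by (simp add: L_def distrib_left)
      finally show "2 * K < e * L" .
    qed
    have "L \<le> L ^ (m - 1)" using L assms(1) by (intro self_le_power) auto
    then have "K / L ^ (m - 1) \<le> K / L" using L K by (intro divide_left_mono) auto
    also have "\<dots> < e / 2" using KL L by (auto simp: field_simps)
    finally have small: "K / L ^ (m - 1) < e / 2" .
    show "\<exists>B>0. \<forall>a b. ball 0 B \<subseteq> cbox a b \<longrightarrow>
        (\<exists>z. ((\<lambda>u. if u \<in> UNIV then ?P u else 0) has_integral z) (cbox a b) \<and> cmod (z - I) < e)"
    proof (intro exI[of _ "L + 1"] conjI allI impI)
      fix a b :: real assume "ball 0 (L + 1) \<subseteq> cbox a b"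
      moreover have "-L \<in> ball 0 (L + 1)" "L \<in> ball 0 (L + 1)" using L by simp_all
      ultimately have "-L \<in> cbox a b" "L \<in> cbox a b" by blast+
      then have ab: "a \<le> -L" "L \<le> b" by auto
      have "cmod (integral {a..b} ?P - integral {-L..L} ?P) < e / 2"
        by (rule order_le_less_trans[OF trunc[OF L(1) ab] small])
      moreover have "cmod (integral {-L..L} ?P - I) < e / 2"
        unfolding norm_minus_commute[of _ I] by (rule order_le_less_trans[OF close[OF L(1)] small])
      ultimately have "cmod (integral {a..b} ?P - I) < e / 2 + e / 2"
        by (rule norm_diff_triangle_less)
      moreover have "(?P has_integral integral {a..b} ?P) {a..b}"
        by (intro integrable_integral integrable_continuous_real continuous_intros)
      ultimately show "\<exists>z. ((\<lambda>u. if u \<in> UNIV then ?P u else 0) has_integral z) (cbox a b) \<and> cmod (z - I) < e"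
        by (intro exI[of _ "integral {a..b} ?P"] conjI) simp_all
    qed (use L in auto)
  qed
  then have "I = of_real (2 * pi) * attractor m \<beta> x"
  proof -
    assume "(?P has_integral I) UNIV"
    moreover have "exp (- \<i> * of_real x * of_real u) * exp (- \<beta> * of_real u ^ m) = ?P u" for u
      unfolding exp_add[symmetric] by (rule arg_cong[where f = exp]) simp
    ultimately show ?thesis by (simp only: attractor_def integral_unique) simp
  qed
  with close[of M] show ?thesis unfolding K_def by (simp only: norm_minus_commute order_refl)
qed

section \<open>Integrals over a fixed neighbourhood\<close>

lemma powr_neg_tendsto_0: "e < 0 \<Longrightarrow> (\<lambda>n. real n powr e) \<longlonglongrightarrow> 0"
  by (rule tendsto_neg_powr[OF _ filterlim_real_sequentially])

lemma eventually_mult_le: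
  assumes "f \<longlonglongrightarrow> (0::real)" "\<epsilon> > 0"
  shows "\<forall>\<^sub>F n in sequentially. K * f n \<le> \<epsilon>"
proof -
  have "(\<lambda>n. K * f n) \<longlonglongrightarrow> K * 0" by (intro tendsto_intros assms)
  then have "\<forall>\<^sub>F n in sequentially. K * f n < \<epsilon>" using assms(2) by (intro order_tendstoD) auto
  then show ?thesis by (rule eventually_mono) simp
qed

context degenerate_phase
begin

text \<open>This is the identity $N t^m = 1$ for $N = n$ and $t = n^{-1/m}$.\<close>

lemma scale_power:
  assumes "n > 0"
  shows "real n * (real n powr (- 1 / real m)) ^ m = 1"
proof -
  have "(real n powr (- 1 / real m)) ^ m = real n powr (- 1)"
    using assms m by (subst powr_power) auto
  then show ?thesis using assms by (simp add: powr_minus_divide)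
qed

lemma scale_tendsto_0: "(\<lambda>n. real n powr (- 1 / real m)) \<longlonglongrightarrow> 0"
  using m by (intro powr_neg_tendsto_0) simp

text \<open>The truncation width $M$ is fixed first, so large that the tails of the integral over the
  neighbourhood and of the attractor together cost at most $\epsilon/2$ on the scale $n^{-1/m}$.  Then $n$ is taken large enough for
  the central window to converge.  The pair $(x,y)$ is quantified inside, which makes the limit uniform
  for $x$ in a compact set and arbitrary rounding of $y$.\<close>

lemma resonant_asymptotics:
  assumes \<beta>: "\<beta> \<noteq> 0" and \<delta>: "0 < \<delta>" "\<delta> \<le> r" and X: "X \<ge> 0" and \<epsilon>: "\<epsilon> > 0"
  shows "\<forall>\<^sub>F n in sequentially. \<forall>x y. \<bar>x\<bar> \<le> X \<longrightarrow> \<bar>y * (real n powr (- 1 / real m)) - x\<bar> \<le> real n powr (- 1 / real m) \<longrightarrow>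
    cmod (integral {-\<delta>..\<delta>} (wave n y) - of_real (real n powr (- 1 / real m)) * (of_real (2 * pi) * attractor m \<beta> x))
      \<le> \<epsilon> * real n powr (- 1 / real m)"
proof -
  define K1 where "K1 = 2 * (4 / c + 4 * C / c\<^sup>2)"
  define K2 where "K2 = 2 * (4 / (m * cmod \<beta>) + 4 * (real m * real m * cmod \<beta>) / (m * cmod \<beta>)\<^sup>2)"
  \<comment> \<open>Each summand secures one of the conditions on $M^{m-1} \ge M$ below: the two frequency conditions and the smallness of the tails.\<close>
  define M where "M = 1 + 2 * (X + 1) / c + 2 * X / (m * cmod \<beta>) + 2 * (K1 + K2) / \<epsilon>"
  have K: "K1 \<ge> 0" "K2 \<ge> 0" unfolding K1_def K2_def using c C by (auto intro!: add_nonneg_nonneg divide_nonneg_nonneg)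
  have m\<beta>: "m * cmod \<beta> > 0" using m \<beta> by simp
  have parts: "2 * (X + 1) / c \<ge> 0" "2 * X / (m * cmod \<beta>) \<ge> 0" "2 * (K1 + K2) / \<epsilon> \<ge> 0"
    using X c m\<beta> K \<epsilon> by (auto intro!: divide_nonneg_nonneg)
  have M1: "M \<ge> 1" using parts by (simp add: M_def)
  have MM: "M \<le> M ^ (m - 1)" using M1 m by (intro self_le_power) auto
  have Mc: "2 * (X + 1) \<le> c * M ^ (m - 1)"
  proof -
    have "2 * (X + 1) / c \<le> M ^ (m - 1)" using parts MM by (simp add: M_def)
    then show ?thesis using c by (simp add: field_simps)
  qed
  have M\<beta>: "2 * X \<le> m * cmod \<beta> * M ^ (m - 1)"
  proof -
    have "2 * X / (m * cmod \<beta>) \<le> M ^ (m - 1)" using parts MM unfolding M_def by linarith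
    then show ?thesis using m\<beta> by (simp add: divide_le_eq mult.commute)
  qed
  have MK: "(K1 + K2) / M ^ (m - 1) \<le> \<epsilon> / 2"
  proof -
    have "2 * (K1 + K2) / \<epsilon> \<le> M ^ (m - 1)" using parts MM unfolding M_def by linarith
    then show ?thesis using \<epsilon> M1 by (simp add: field_simps)
  qed
  have ev: "\<forall>\<^sub>F n in sequentially. n > 0 \<and> M * real n powr (- 1 / real m) \<le> \<delta> \<and> 1 * real n powr (- 1 / real m) \<le> 1
      \<and> 2 * M * (C * M ^ (m + 1) + M) * real n powr (- 1 / real m) \<le> \<epsilon> / 2"
    by (intro eventually_conj eventually_gt_at_top eventually_mult_le scale_tendsto_0) (use \<delta> \<epsilon> in auto)
  then show ?thesis
  proof eventually_elim
    case (elim n)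
    define t where "t = real n powr (- 1 / real m)"
    have t: "t > 0" "M * t \<le> \<delta>" "t \<le> 1" "2 * M * (C * M ^ (m + 1) + M) * t \<le> \<epsilon> / 2"
      and Nt: "real n * t ^ m = 1"
      using elim scale_power[of n] by (auto simp: t_def)
    show ?case unfolding t_def[symmetric]
    proof (intro allI impI)
      fix x y assume x: "\<bar>x\<bar> \<le> X" and yx: "\<bar>y * t - x\<bar> \<le> t"
      have "\<bar>y\<bar> * t = \<bar>y * t\<bar>" using t by (simp add: abs_mult)
      then have "\<bar>y\<bar> * t \<le> X + 1" using x yx t(3) by linarith
      then have y: "\<bar>y\<bar> \<le> (X + 1) / t" using t(1) by (simp add: field_simps)
      let ?J = "integral {-\<delta>..\<delta>} (wave n y)"
      let ?Jc = "integral {- (M * t)..M * t} (wave n y)"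
      let ?I = "integral {-M..M} (\<lambda>u. exp (- \<beta> * of_real u ^ m - \<i> * of_real x * of_real u))"
      let ?A = "of_real (2 * pi) * attractor m \<beta> x"
      have M0: "M > 0" using M1 by simp
      have 1: "cmod (?J - ?Jc) \<le> t * (K1 / M ^ (m - 1))"
        using wave_integral_truncate[OF Nt t(1) y M0 Mc, of "-\<delta>" \<delta>] t(2) \<delta>(2) by (simp add: K1_def mult_ac)
      have "cmod (?Jc / t - ?I) \<le> \<epsilon> / 2"
      proof (rule order_trans[OF wave_integral_centre[OF Nt t(1) M0 _ yx]])
        show "M * t \<le> r" using t(2) \<delta>(2) by linarith
        have "2 * M * t * (C * M ^ (m + 1) + M) = 2 * M * (C * M ^ (m + 1) + M) * t" by (simp only: mult_ac)
        then show "2 * M * t * (C * M ^ (m + 1) + M) \<le> \<epsilon> / 2" using t(4) by linarith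
      qed
      moreover have "cmod (?I - ?A) \<le> K2 / M ^ (m - 1)"
        using attractor_truncate[OF m \<beta> Re_coeff(1) Re_coeff(2) x M0 M\<beta>] by (simp add: K2_def)
      ultimately have "cmod (?Jc / t - ?A) \<le> \<epsilon> / 2 + K2 / M ^ (m - 1)"
        by (rule norm_diff_triangle_le)
      then have "t * cmod (?Jc / t - ?A) \<le> t * (\<epsilon> / 2 + K2 / M ^ (m - 1))"
        using t(1) by (intro mult_left_mono) auto
      moreover have "?Jc - of_real t * ?A = of_real t * (?Jc / t - ?A)" using t(1) by (simp add: field_simps)
      ultimately have 2: "cmod (?Jc - of_real t * ?A) \<le> t * (\<epsilon> / 2 + K2 / M ^ (m - 1))"
        using t(1) by (simp add: norm_mult)
      have "cmod (?J - of_real t * ?A) \<le> t * (K1 / M ^ (m - 1)) + t * (\<epsilon> / 2 + K2 / M ^ (m - 1))"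
        by (rule norm_diff_triangle_le[OF 1 2])
      also have "\<dots> = t * (\<epsilon> / 2 + (K1 + K2) / M ^ (m - 1))" by (simp add: algebra_simps add_divide_distrib)
      also have "\<dots> \<le> t * (\<epsilon> / 2 + \<epsilon> / 2)" using t(1) by (intro mult_left_mono add_left_mono MK) auto
      finally show "cmod (?J - of_real t * ?A) \<le> \<epsilon> * t" by (simp add: mult.commute)
    qed
  qed
qed

text \<open>The frequency is $O(n^{1/m'})$, hence $O(n^{1/m})$.  So the integral is $O(n^{-1/m})$, which is
  $o(n^{-1/m'})$.\<close>

lemma lower_order_negligible:
  assumes \<delta>: "0 < \<delta>" "\<delta> \<le> r" and m': "m < m'" and X: "X \<ge> 0" and \<epsilon>: "\<epsilon> > 0"
  shows "\<forall>\<^sub>F n in sequentially. \<forall>y. \<bar>y * (real n powr (- 1 / real m'))\<bar> \<le> X \<longrightarrow>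
    cmod (integral {-\<delta>..\<delta>} (wave n y)) \<le> \<epsilon> * real n powr (- 1 / real m')"
proof -
  define M where "M = 1 + 2 * X / c"
  have M1: "M \<ge> 1" using X c by (simp add: M_def)
  have MM: "M \<le> M ^ (m - 1)" using M1 m by (intro self_le_power) auto
  have Mc: "2 * X \<le> c * M ^ (m - 1)"
  proof -
    have "2 * X / c \<le> M ^ (m - 1)" using MM by (simp add: M_def)
    then show ?thesis using c by (simp add: field_simps)
  qed
  define K where "K = 2 * M + 2 * (4 / c + 4 * C / c\<^sup>2) / M ^ (m - 1)"
  have e: "- 1 / real m + 1 / real m' < 0" using m m' by (simp add: field_simps)
  have ev: "\<forall>\<^sub>F n in sequentially. n > 0 \<and> M * real n powr (- 1 / real m) \<le> \<delta>
      \<and> K * real n powr (- 1 / real m + 1 / real m') \<le> \<epsilon>"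
    by (intro eventually_conj eventually_gt_at_top eventually_mult_le scale_tendsto_0 powr_neg_tendsto_0 e)
       (use \<delta> \<epsilon> in auto)
  then show ?thesis
  proof eventually_elim
    case (elim n)
    define t where "t = real n powr (- 1 / real m)"
    define t' where "t' = real n powr (- 1 / real m')"
    have t: "t > 0" "M * t \<le> \<delta>" and t': "t' > 0" and Nt: "real n * t ^ m = 1"
      using elim scale_power[of n] by (auto simp: t_def t'_def)
    have tt: "t = real n powr (- 1 / real m + 1 / real m') * t'"
      unfolding t_def t'_def by (simp flip: powr_add)
    have "t \<le> t'" unfolding t_def t'_def using elim e by (intro powr_mono) auto
    show ?case unfolding t'_def[symmetric]
    proof (intro allI impI)
      fix y assume "\<bar>y * t'\<bar> \<le> X"
      then have "\<bar>y\<bar> * t' \<le> X" using t' by (simp add: abs_mult)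
      moreover have "\<bar>y\<bar> * t \<le> \<bar>y\<bar> * t'" using \<open>t \<le> t'\<close> by (intro mult_left_mono) auto
      ultimately have y: "\<bar>y\<bar> \<le> X / t" using t(1) by (simp add: field_simps)
      have M0: "M > 0" using M1 by simp
      have "cmod (integral {-\<delta>..\<delta>} (wave n y)) \<le> K * t"
        using wave_integral_bound[OF Nt t(1) y M0 Mc t(2) \<delta>(2)] by (simp add: K_def)
      also have "\<dots> = (K * real n powr (- 1 / real m + 1 / real m')) * t'" by (subst tt) simp
      also have "\<dots> \<le> \<epsilon> * t'" using elim t' by (intro mult_right_mono) auto
      finally show "cmod (integral {-\<delta>..\<delta>} (wave n y)) \<le> \<epsilon> * t'" .
    qed
  qed
qed

text \<open>Here $g$ is the difference of two drifts.  The frequency is $gn + O(n^{1/m'})$, and the integral is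
  $O(1/n)$, which is $o(n^{-1/m'})$ because $m' \ge 2$.\<close>

lemma nonresonant_negligible:
  fixes g :: real
  assumes m': "m' \<ge> 2" and g: "g \<noteq> 0" and X: "X \<ge> 0" and \<epsilon>: "\<epsilon> > 0"
    and \<delta>: "0 < \<delta>" "\<delta> \<le> r" "\<delta> \<le> 1" "C * \<delta> \<le> \<bar>g\<bar> / 4"
  shows "\<forall>\<^sub>F n in sequentially. \<forall>y. \<bar>(y - g * n) * (real n powr (- 1 / real m'))\<bar> \<le> X \<longrightarrow>
    cmod (integral {-\<delta>..\<delta>} (wave n y)) \<le> \<epsilon> * real n powr (- 1 / real m')"
proof -
  define K where "K = 4 / (\<bar>g\<bar> / 2) + 8 * C / (\<bar>g\<bar> / 2)\<^sup>2"
  have e: "- 1 + 1 / real m' < 0" using m' by (simp add: field_simps)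
  have ev: "\<forall>\<^sub>F n in sequentially. n > 0 \<and> X * real n powr (- 1 + 1 / real m') \<le> \<bar>g\<bar> / 2
      \<and> K * real n powr (- 1 + 1 / real m') \<le> \<epsilon>"
    by (intro eventually_conj eventually_gt_at_top eventually_mult_le powr_neg_tendsto_0 e)
       (use g \<epsilon> in auto)
  then show ?thesis
  proof eventually_elim
    case (elim n)
    define s where "s = real n powr (- 1 + 1 / real m')"
    define t where "t = real n powr (- 1 / real m')"
    have n: "real n > 0" and t: "t > 0" using elim by (auto simp: t_def)
    have "s * t = real n powr (- 1)" unfolding s_def t_def by (simp flip: powr_add)
    then have st: "real n * (s * t) = 1" using n by (simp add: powr_minus_divide)
    show ?case unfolding t_def[symmetric]
    proof (intro allI impI)
      fix y assume "\<bar>(y - g * n) * t\<bar> \<le> X"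
      then have "\<bar>y - g * n\<bar> * t \<le> X" using t by (simp add: abs_mult)
      then have "(\<bar>y - g * n\<bar> * t) * (real n * s) \<le> X * (real n * s)"
        by (intro mult_right_mono) (auto simp: s_def)
      also have "(\<bar>y - g * n\<bar> * t) * (real n * s) = \<bar>y - g * n\<bar>" using st by (simp add: mult_ac)
      also have "X * (real n * s) = real n * (X * s)" by simp
      also have "\<dots> \<le> real n * (\<bar>g\<bar> / 2)" using elim by (intro mult_left_mono) (auto simp: s_def)
      finally have "\<bar>y - g * n\<bar> \<le> real n * (\<bar>g\<bar> / 2)" .
      moreover have "\<bar>g * n\<bar> = \<bar>g\<bar> * n" by (simp add: abs_mult)
      moreover have "\<bar>g * n\<bar> \<le> \<bar>y\<bar> + \<bar>y - g * n\<bar>" by linarith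
      ultimately have y: "\<bar>g\<bar> / 2 * real n \<le> \<bar>y\<bar>" by (simp add: mult.commute)
      have "cmod (integral {-\<delta>..\<delta>} (wave n y)) \<le> K / n"
        using wave_integral_nonresonant[OF n _ y \<delta>(1-3)] g \<delta>(4) by (simp add: K_def)
      also have "\<dots> = (K * s) * t" using st n by (simp add: field_simps)
      also have "\<dots> \<le> \<epsilon> * t" using elim t by (intro mult_right_mono) (auto simp: s_def)
      finally show "cmod (integral {-\<delta>..\<delta>} (wave n y)) \<le> \<epsilon> * t" .
    qed
  qed
qed

end

section \<open>Fourier inversion and unimodular points\<close>

lemma fourier_eq_sum:
  assumes "finite {x. \<phi> x \<noteq> 0}"
  shows "fourier \<phi> \<xi> = (\<Sum>x | \<phi> x \<noteq> 0. \<phi> x * exp (\<i> * of_int x * of_real \<xi>))"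
proof -
  have "fourier \<phi> \<xi> = infsum (\<lambda>x. \<phi> x * exp (\<i> * of_int x * of_real \<xi>)) {x. \<phi> x \<noteq> 0}"
    unfolding fourier_def by (rule infsum_cong_neutral) auto
  then show ?thesis using assms by simp
qed

lemma conv_power_Suc:
  assumes "finite {x. \<phi> x \<noteq> 0}"
  shows "conv_power \<phi> (Suc n) k = (\<Sum>y | \<phi> y \<noteq> 0. conv_power \<phi> n (k - y) * \<phi> y)"
proof (cases n)
  case 0
  have "(\<Sum>y | \<phi> y \<noteq> 0. conv_power \<phi> 0 (k - y) * \<phi> y) = (\<Sum>y | \<phi> y \<noteq> 0. if y = k then \<phi> y else 0)"
    by (intro sum.cong) auto
  also have "\<dots> = \<phi> k" using assms by simp
  finally show ?thesis using 0 by simp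
next
  case (Suc n')
  have "conv_power \<phi> (Suc n) k = infsum (\<lambda>y. conv_power \<phi> n (k - y) * \<phi> y) {x. \<phi> x \<noteq> 0}"
    unfolding Suc conv_power.simps by (rule infsum_cong_neutral) auto
  then show ?thesis using assms by simp
qed

lemma has_integral_character:
  fixes k :: int
  shows "((\<lambda>\<xi>. exp (- \<i> * of_int k * of_real \<xi>)) has_integral (if k = 0 then 2 * pi else 0)) {\<theta>..\<theta> + 2 * pi}"
proof (cases "k = 0")
  case True
  then show ?thesis using has_integral_const_real[of "1::complex" \<theta> "\<theta> + 2 * pi"]
    by (simp add: scaleR_conv_of_real)
next
  case False
  let ?f = "\<lambda>\<xi>::real. exp (- \<i> * of_int k * of_real \<xi>) / (- \<i> * of_int k)"
  have "((\<lambda>\<xi>. exp (- \<i> * of_int k * of_real \<xi>)) has_integral ?f (\<theta> + 2 * pi) - ?f \<theta>) {\<theta>..\<theta> + 2 * pi}"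
  proof (rule fundamental_theorem_of_calculus)
    fix x :: real
    have "((\<lambda>z. exp (- \<i> * of_int k * z) / (- \<i> * of_int k)) has_field_derivative exp (- \<i> * of_int k * of_real x)) (at (of_real x))"
      using False by (auto intro!: derivative_eq_intros)
    then show "(?f has_vector_derivative exp (- \<i> * of_int k * of_real x)) (at x within {\<theta>..\<theta> + 2 * pi})"
      by (rule has_vector_derivative_real_field)
  qed simp
  moreover have "exp (- \<i> * of_int k * of_real (\<theta> + 2 * pi)) = exp (- \<i> * of_int k * of_real \<theta>)"
  proof -
    have "exp (- \<i> * of_int k * of_real (\<theta> + 2 * pi))
        = exp (- \<i> * of_int k * of_real \<theta>) * exp (2 * of_int (- k) * of_real pi * \<i>)"
      unfolding exp_add[symmetric] by (rule arg_cong[where f = exp]) (simp add: algebra_simps)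
    also have "exp (2 * of_int (- k) * of_real pi * \<i>) = 1"
      using exp_integer_2pi[of "of_int (- k)"] by simp
    finally show ?thesis by simp
  qed
  ultimately show ?thesis using False by (simp only: diff_self) simp
qed

text \<open>The base point $\theta$ of the period is left free, so that the unimodular points can later be placed in
  the interior of the period.\<close>

lemma conv_power_fourier:
  assumes fin: "finite {x. \<phi> x \<noteq> 0}"
  shows "((\<lambda>\<xi>. fourier \<phi> \<xi> ^ n * exp (- \<i> * of_int k * of_real \<xi>)) has_integral
    of_real (2 * pi) * conv_power \<phi> n k) {\<theta>..\<theta> + 2 * pi}"
proof (induction n arbitrary: k)
  case 0
  show ?case using has_integral_character[of k \<theta>] by (auto split: if_splits)
next
  case (Suc n)
  have "((\<lambda>\<xi>. \<Sum>y | \<phi> y \<noteq> 0. fourier \<phi> \<xi> ^ n * exp (- \<i> * of_int (k - y) * of_real \<xi>) * \<phi> y) has_integral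
      (\<Sum>y | \<phi> y \<noteq> 0. of_real (2 * pi) * conv_power \<phi> n (k - y) * \<phi> y)) {\<theta>..\<theta> + 2 * pi}"
    by (intro has_integral_sum fin has_integral_mult_left Suc)
  also have "(\<Sum>y | \<phi> y \<noteq> 0. of_real (2 * pi) * conv_power \<phi> n (k - y) * \<phi> y)
      = of_real (2 * pi) * conv_power \<phi> (Suc n) k"
    unfolding conv_power_Suc[OF fin] by (simp add: sum_distrib_left mult_ac)
  also have "(\<lambda>\<xi>. \<Sum>y | \<phi> y \<noteq> 0. fourier \<phi> \<xi> ^ n * exp (- \<i> * of_int (k - y) * of_real \<xi>) * \<phi> y)
      = (\<lambda>\<xi>. fourier \<phi> \<xi> ^ Suc n * exp (- \<i> * of_int k * of_real \<xi>))"
  proof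
    fix \<xi> :: real
    have "exp (- \<i> * of_int (k - y) * of_real \<xi>)
        = exp (\<i> * of_int y * of_real \<xi>) * exp (- \<i> * of_int k * of_real \<xi>)" for y
      unfolding exp_add[symmetric] by (rule arg_cong[where f = exp]) (simp add: algebra_simps)
    then have "(\<Sum>y | \<phi> y \<noteq> 0. fourier \<phi> \<xi> ^ n * exp (- \<i> * of_int (k - y) * of_real \<xi>) * \<phi> y)
        = (\<Sum>y | \<phi> y \<noteq> 0. \<phi> y * exp (\<i> * of_int y * of_real \<xi>)) * (fourier \<phi> \<xi> ^ n * exp (- \<i> * of_int k * of_real \<xi>))"
      unfolding sum_distrib_right by (intro sum.cong refl) simp
    then show "(\<Sum>y | \<phi> y \<noteq> 0. fourier \<phi> \<xi> ^ n * exp (- \<i> * of_int (k - y) * of_real \<xi>) * \<phi> y)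
        = fourier \<phi> \<xi> ^ Suc n * exp (- \<i> * of_int k * of_real \<xi>)"
      using fourier_eq_sum[OF fin, of \<xi>] by simp
  qed
  finally show ?case .
qed

lemma fourier_periodic:
  assumes "finite {x. \<phi> x \<noteq> 0}"
  shows "fourier \<phi> (t + 2 * pi) = fourier \<phi> t"
  unfolding fourier_eq_sum[OF assms]
proof (rule sum.cong[OF refl])
  fix x :: int
  have "exp (\<i> * of_int x * of_real (t + 2 * pi)) = exp (\<i> * of_int x * of_real t) * exp (2 * of_int x * of_real pi * \<i>)"
    unfolding exp_add[symmetric] by (rule arg_cong[where f = exp]) (simp add: algebra_simps)
  also have "exp (2 * of_int x * of_real pi * \<i>) = 1"
    using exp_integer_2pi[of "of_int x"] by simp
  finally show "\<phi> x * exp (\<i> * of_int x * of_real (t + 2 * pi)) = \<phi> x * exp (\<i> * of_int x * of_real t)" by simp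
qed

lemma norm_fourier_le_1:
  assumes "finite {x. \<phi> x \<noteq> 0}" "(SUP t. cmod (fourier \<phi> t)) = 1"
  shows "cmod (fourier \<phi> t) \<le> 1"
proof -
  have "cmod (fourier \<phi> t) \<le> (\<Sum>x | \<phi> x \<noteq> 0. cmod (\<phi> x))" for t
    unfolding fourier_eq_sum[OF assms(1)] by (rule order_trans[OF norm_sum]) (simp add: norm_mult)
  then have "bdd_above (range (\<lambda>t. cmod (fourier \<phi> t)))" by (intro bdd_aboveI) auto
  from cSUP_upper[OF UNIV_I this, of t] show ?thesis using assms(2) by simp
qed

lemma fourier_continuous:
  assumes "finite {x. \<phi> x \<noteq> 0}"
  shows "continuous_on S (fourier \<phi>)"
  unfolding fourier_eq_sum[OF assms] by (intro continuous_intros)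

text \<open>With $z = e^{i\xi}$ and the support contained in $\{a,\dots,b\}$, the function $z^{-a}\hat\phi$ is a
  polynomial $P(z)$.  Reversing and conjugating its coefficients gives a polynomial $P'$ that equals
  $z^{b}\,\overline{\hat\phi}$ on the unit circle.  So the unimodular points are roots of
  $PP' - z^{b-a}$.  Its value at $0$ is $\phi(a)\overline{\phi(b)} \ne 0$ because $a < b$, and this is
  where a support of more than one point is needed.\<close>

lemma finite_unimodular_points:
  assumes "admissible_support \<phi>"
  shows "finite (unimodular_points \<phi>)"
proof -
  let ?A = "{x. \<phi> x \<noteq> 0}"
  have fin: "finite ?A" and card: "card ?A > 1" using assms by (auto simp: admissible_support_def)
  define a where "a = Min ?A"
  define b where "b = Max ?A"
  have ne: "?A \<noteq> {}" using card by force
  have ab: "a \<in> ?A" "b \<in> ?A" "\<And>x. x \<in> ?A \<Longrightarrow> a \<le> x \<and> x \<le> b"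
    using fin ne unfolding a_def b_def by (auto intro: Min_in Max_in simp del: mem_Collect_eq)
  have "a \<noteq> b"
  proof
    assume "a = b"
    then have "?A \<subseteq> {a}" using ab(3) by force
    then show False using card card_mono[of "{a}" ?A] by simp
  qed
  then have lt: "a < b" using ab(1,3) ab(2) by force
  define P where "P = (\<Sum>x\<in>?A. monom (\<phi> x) (nat (x - a)))"
  define P' where "P' = (\<Sum>x\<in>?A. monom (cnj (\<phi> x)) (nat (b - x)))"
  define Q where "Q = P * P' - monom 1 (nat (b - a))"
  have "poly P 0 = (\<Sum>x\<in>?A. if x = a then \<phi> x else 0)"
    unfolding P_def poly_sum by (intro sum.cong) (auto simp: poly_monom power_0_left dest!: ab(3)[OF CollectI])
  then have P0: "poly P 0 = \<phi> a" using fin ab(1) by simp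
  have "poly P' 0 = (\<Sum>x\<in>?A. if x = b then cnj (\<phi> x) else 0)"
    unfolding P'_def poly_sum by (intro sum.cong) (auto simp: poly_monom power_0_left dest!: ab(3)[OF CollectI])
  then have P'0: "poly P' 0 = cnj (\<phi> b)" using fin ab(2) by simp
  have "poly Q 0 \<noteq> 0" using P0 P'0 ab(1,2) lt by (simp add: Q_def poly_monom power_0_left)
  then have "Q \<noteq> 0" by auto
  have root: "poly Q (exp (\<i> * of_real \<xi>)) = 0" if "cmod (fourier \<phi> \<xi>) = 1" for \<xi>
  proof -
    have pw: "exp (\<i> * of_real \<xi>) ^ nat j = exp (\<i> * of_int j * of_real \<xi>)" if "j \<ge> 0" for j
      using that by (simp add: exp_of_nat_mult[symmetric] mult_ac)
    have 1: "poly P (exp (\<i> * of_real \<xi>)) = exp (- \<i> * of_int a * of_real \<xi>) * fourier \<phi> \<xi>"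
    proof -
      have "poly P (exp (\<i> * of_real \<xi>)) = (\<Sum>x\<in>?A. \<phi> x * exp (\<i> * of_int (x - a) * of_real \<xi>))"
        unfolding P_def poly_sum using ab(3) by (intro sum.cong) (simp_all add: poly_monom pw del: of_int_diff)
      also have "\<dots> = exp (- \<i> * of_int a * of_real \<xi>) * fourier \<phi> \<xi>"
        unfolding fourier_eq_sum[OF fin] sum_distrib_left
      proof (rule sum.cong[OF refl])
        fix x
        have "exp (\<i> * of_int (x - a) * of_real \<xi>)
            = exp (- \<i> * of_int a * of_real \<xi>) * exp (\<i> * of_int x * of_real \<xi>)"
          unfolding exp_add[symmetric] by (rule arg_cong[where f = exp]) (simp add: algebra_simps)
        then show "\<phi> x * exp (\<i> * of_int (x - a) * of_real \<xi>)
            = exp (- \<i> * of_int a * of_real \<xi>) * (\<phi> x * exp (\<i> * of_int x * of_real \<xi>))"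
          by (simp only: mult.left_commute)
      qed
      finally show ?thesis .
    qed
    have 2: "poly P' (exp (\<i> * of_real \<xi>)) = exp (\<i> * of_int b * of_real \<xi>) * cnj (fourier \<phi> \<xi>)"
    proof -
      have "poly P' (exp (\<i> * of_real \<xi>)) = (\<Sum>x\<in>?A. cnj (\<phi> x) * exp (\<i> * of_int (b - x) * of_real \<xi>))"
        unfolding P'_def poly_sum using ab(3) by (intro sum.cong) (simp_all add: poly_monom pw del: of_int_diff)
      also have "\<dots> = exp (\<i> * of_int b * of_real \<xi>) * cnj (fourier \<phi> \<xi>)"
        unfolding fourier_eq_sum[OF fin] sum_distrib_left cnj_sum
      proof (rule sum.cong[OF refl])
        fix x
        have "exp (\<i> * of_int (b - x) * of_real \<xi>)
            = exp (\<i> * of_int b * of_real \<xi>) * exp (cnj (\<i> * of_int x * of_real \<xi>))"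
          unfolding exp_add[symmetric] by (rule arg_cong[where f = exp]) (simp add: algebra_simps)
        then show "cnj (\<phi> x) * exp (\<i> * of_int (b - x) * of_real \<xi>)
            = exp (\<i> * of_int b * of_real \<xi>) * cnj (\<phi> x * exp (\<i> * of_int x * of_real \<xi>))"
          by (simp only: mult.left_commute complex_cnj_mult exp_cnj)
      qed
      finally show ?thesis .
    qed
    have "poly (P * P') (exp (\<i> * of_real \<xi>))
        = (exp (- \<i> * of_int a * of_real \<xi>) * exp (\<i> * of_int b * of_real \<xi>)) * (fourier \<phi> \<xi> * cnj (fourier \<phi> \<xi>))"
      by (simp add: 1 2)
    also have "fourier \<phi> \<xi> * cnj (fourier \<phi> \<xi>) = 1"
      using that by (simp add: complex_norm_square[symmetric])
    also have "exp (- \<i> * of_int a * of_real \<xi>) * exp (\<i> * of_int b * of_real \<xi>) = exp (\<i> * of_int (b - a) * of_real \<xi>)"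
      unfolding exp_add[symmetric] by (rule arg_cong[where f = exp]) (simp add: algebra_simps)
    finally show ?thesis using pw[of "b - a"] lt by (simp add: Q_def poly_monom)
  qed
  have "inj_on (\<lambda>\<xi>::real. exp (\<i> * of_real \<xi>)) (unimodular_points \<phi>)"
  proof (rule inj_on_inverseI[where g = Arg])
    show "Arg (exp (\<i> * of_real \<xi>)) = \<xi>" if "\<xi> \<in> unimodular_points \<phi>" for \<xi>
      using that by (subst Arg_exp) (auto simp: unimodular_points_def)
  qed
  moreover have "(\<lambda>\<xi>::real. exp (\<i> * of_real \<xi>)) ` unimodular_points \<phi> \<subseteq> {z. poly Q z = 0}"
    using root by (auto simp: unimodular_points_def)
  ultimately show ?thesis
    using poly_roots_finite[OF \<open>Q \<noteq> 0\<close>] finite_subset finite_imageD by blast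
qed

section \<open>Local expansion of the logarithm\<close>

text \<open>The constants of an expansion are limits, which makes them unique.\<close>

lemma log_expansion_tendsto:
  assumes "log_expansion \<phi> p m \<alpha> \<beta>"
  defines "f \<equiv> \<lambda>\<xi>. Ln (fourier \<phi> (\<xi> + p) / fourier \<phi> p)"
  shows "((\<lambda>\<xi>. f \<xi> / of_real \<xi>) \<longlongrightarrow> \<i> * of_real \<alpha>) (at 0)"
    and "((\<lambda>\<xi>. (f \<xi> - \<i> * of_real \<alpha> * of_real \<xi>) / of_real \<xi> ^ m) \<longlongrightarrow> - \<beta>) (at 0)"
proof -
  let ?e = "\<lambda>\<xi>. f \<xi> - (\<i> * of_real \<alpha> * of_real \<xi> - \<beta> * of_real \<xi> ^ m)"
  have m: "m \<ge> 2" and "?e \<in> o[at 0](\<lambda>\<xi>. of_real \<xi> ^ m)"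
    using assms by (auto simp: log_expansion_def f_def)
  then have e: "((\<lambda>\<xi>. ?e \<xi> / of_real \<xi> ^ m) \<longlongrightarrow> 0) (at 0)" by (intro smalloD_tendsto)
  have nz: "\<forall>\<^sub>F \<xi>::real in at 0. \<xi> \<noteq> 0" by (rule eventually_neq_at_within)
  have id0: "((\<lambda>\<xi>::real. complex_of_real \<xi> ^ k) \<longlongrightarrow> 0) (at 0)" if "k > 0" for k
    using that by (auto intro!: tendsto_eq_intros)
  have "((\<lambda>\<xi>. ?e \<xi> / of_real \<xi> ^ m * of_real \<xi> ^ (m - 1) - \<beta> * of_real \<xi> ^ (m - 1) + \<i> * of_real \<alpha>)
      \<longlongrightarrow> 0 * 0 - \<beta> * 0 + \<i> * of_real \<alpha>) (at 0)"
    using m by (intro tendsto_intros e id0) auto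
  moreover have "\<forall>\<^sub>F \<xi> in at 0. ?e \<xi> / of_real \<xi> ^ m * of_real \<xi> ^ (m - 1) - \<beta> * of_real \<xi> ^ (m - 1) + \<i> * of_real \<alpha>
      = f \<xi> / of_real \<xi>"
    using nz
  proof eventually_elim
    case (elim \<xi>)
    obtain k where k: "m = Suc k" using m by (cases m) auto
    show ?case using elim by (simp add: k field_simps)
  qed
  ultimately have "((\<lambda>\<xi>. f \<xi> / of_real \<xi>) \<longlongrightarrow> 0 * 0 - \<beta> * 0 + \<i> * of_real \<alpha>) (at 0)"
    by (rule Lim_transform_eventually)
  then show "((\<lambda>\<xi>. f \<xi> / of_real \<xi>) \<longlongrightarrow> \<i> * of_real \<alpha>) (at 0)" by simp
  have "((\<lambda>\<xi>. ?e \<xi> / of_real \<xi> ^ m - \<beta>) \<longlongrightarrow> 0 - \<beta>) (at 0)"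
    by (intro tendsto_intros e)
  moreover have "\<forall>\<^sub>F \<xi> in at 0. ?e \<xi> / of_real \<xi> ^ m - \<beta> = (f \<xi> - \<i> * of_real \<alpha> * of_real \<xi>) / of_real \<xi> ^ m"
    using nz by eventually_elim (simp add: field_simps)
  ultimately have "((\<lambda>\<xi>. (f \<xi> - \<i> * of_real \<alpha> * of_real \<xi>) / of_real \<xi> ^ m) \<longlongrightarrow> 0 - \<beta>) (at 0)"
    by (rule Lim_transform_eventually)
  then show "((\<lambda>\<xi>. (f \<xi> - \<i> * of_real \<alpha> * of_real \<xi>) / of_real \<xi> ^ m) \<longlongrightarrow> - \<beta>) (at 0)" by simp
qed

lemma log_expansion_unique:
  assumes 1: "log_expansion \<phi> p m \<alpha> \<beta>" and 2: "log_expansion \<phi> p m' \<alpha>' \<beta>'"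
  shows "m' = m" "\<alpha>' = \<alpha>" "\<beta>' = \<beta>"
proof -
  have "\<i> * complex_of_real \<alpha> = \<i> * complex_of_real \<alpha>'"
    using log_expansion_tendsto(1)[OF 1] log_expansion_tendsto(1)[OF 2] by (rule tendsto_unique[rotated]) simp
  then show \<alpha>: "\<alpha>' = \<alpha>" by simp
  \<comment> \<open>Dividing by the smaller power makes the expansion of larger order tend to $0$, so the coefficient of the other one would vanish.\<close>
  have not_less: "\<not> a < b" if a: "log_expansion \<phi> p a \<alpha> u" and b: "log_expansion \<phi> p b \<alpha> v" for a b u v
  proof
    assume "a < b"
    let ?d = "\<lambda>\<xi>. Ln (fourier \<phi> (\<xi> + p) / fourier \<phi> p) - \<i> * of_real \<alpha> * of_real \<xi>"
    have "((\<lambda>\<xi>. ?d \<xi> / of_real \<xi> ^ b * of_real \<xi> ^ (b - a)) \<longlongrightarrow> - v * 0 ^ (b - a)) (at 0)"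
      by (intro tendsto_mult log_expansion_tendsto(2)[OF b] tendsto_power) (auto intro!: tendsto_eq_intros)
    moreover have "\<forall>\<^sub>F \<xi> in at 0. ?d \<xi> / of_real \<xi> ^ b * of_real \<xi> ^ (b - a) = ?d \<xi> / of_real \<xi> ^ a"
      using eventually_neq_at_within[of 0 0]
    proof eventually_elim
      case (elim \<xi>)
      then show ?case using \<open>a < b\<close> by (simp add: power_diff)
    qed
    ultimately have "((\<lambda>\<xi>. ?d \<xi> / of_real \<xi> ^ a) \<longlongrightarrow> - v * 0 ^ (b - a)) (at 0)"
      by (rule Lim_transform_eventually)
    from tendsto_unique[OF _ this log_expansion_tendsto(2)[OF a]] have "u = 0" using \<open>a < b\<close> by (simp add: power_0_left)
    then show False using a by (simp add: log_expansion_def)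
  qed
  show m: "m' = m" using not_less[OF 1 2[unfolded \<alpha>]] not_less[OF 2[unfolded \<alpha>] 1] by simp
  show "\<beta>' = \<beta>"
    using tendsto_unique[OF _ log_expansion_tendsto(2)[OF 1] log_expansion_tendsto(2)[OF 2[unfolded \<alpha> m]]] by simp
qed

lemma expansion_constants:
  assumes "log_expansion \<phi> p m \<alpha> \<beta>"
  shows "expansion_order \<phi> p = m" "expansion_drift \<phi> p = \<alpha>" "expansion_coeff \<phi> p = \<beta>"
  unfolding expansion_order_def expansion_drift_def expansion_coeff_def
  using assms log_expansion_unique[OF assms] by (blast intro: the_equality)+

text \<open>Since $\Re h \le 0$ on the real axis with equality at $0$, the derivative of $h$ at $0$ is imaginary.
  Removing the linear part leaves a function with a zero at $0$, which does not vanish identically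
  because $\Re h$ does not.  It therefore factors as $z^m k(z)$ with $k(0) \ne 0$, and
  $m \ge 2$ as its derivative at $0$ vanishes.  The size conditions on the phase follow from bounds for
  $k$, $k'$ and $k''$ on a smaller disc.\<close>

lemma analytic_phase:
  assumes hol: "h holomorphic_on ball 0 R" and "R > 0" and h0: "h 0 = 0"
    and Re_h: "\<And>x. \<bar>x\<bar> < R \<Longrightarrow> Re (h (of_real x)) \<le> 0"
    and nontrivial: "\<exists>x. \<bar>x\<bar> < R \<and> Re (h (of_real x)) \<noteq> 0"
  obtains m \<alpha> \<beta> r c C \<Gamma> \<Gamma>1 \<Gamma>2 where "degenerate_phase m \<beta> r c C \<Gamma> \<Gamma>1 \<Gamma>2" "\<beta> \<noteq> 0" "r < R"
    and "\<And>x. \<bar>x\<bar> \<le> r \<Longrightarrow> h (of_real x) = \<i> * of_real \<alpha> * of_real x + \<Gamma> x"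
proof -
  define a where "a = deriv h 0"
  have dh: "(h has_field_derivative a) (at 0)"
    unfolding a_def using hol \<open>R > 0\<close> by (intro holomorphic_derivI[of _ "ball 0 R"]) auto
  have "Re a = 0"
  proof (rule DERIV_local_max[of "\<lambda>x. Re (h (of_real x))" "Re a" 0 R])
    have "((\<lambda>x. h (of_real x)) has_vector_derivative a) (at 0)"
      by (rule has_vector_derivative_real_field) (use dh in simp)
    then show "((\<lambda>x. Re (h (of_real x))) has_real_derivative Re a) (at 0)"
      unfolding has_real_derivative_iff_has_vector_derivative
      by (rule bounded_linear.has_vector_derivative[OF bounded_linear_Re])
    show "\<forall>y. \<bar>0 - y\<bar> < R \<longrightarrow> Re (h (of_real y)) \<le> Re (h (of_real 0))"
      using Re_h h0 by simp
  qed fact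
  define \<alpha> where "\<alpha> = Im a"
  have a: "a = \<i> * of_real \<alpha>" using \<open>Re a = 0\<close> by (simp add: complex_eq_iff \<alpha>_def)
  define g where "g = (\<lambda>z. h z - a * z)"
  have g_hol: "g holomorphic_on ball 0 R" unfolding g_def by (intro holomorphic_intros hol)
  have g0: "g 0 = 0" by (simp add: g_def h0)
  have R0: "(0::complex) \<in> ball 0 R" using \<open>R > 0\<close> by simp
  have nonconst: "\<not> g constant_on ball 0 R"
  proof
    assume "g constant_on ball 0 R"
    then obtain y where "\<And>z. z \<in> ball 0 R \<Longrightarrow> g z = y" unfolding constant_on_def by blast
    from this this[OF R0] have *: "g z = 0" if "z \<in> ball 0 R" for z using that g0 by simp
    have "Re (h (of_real x)) = 0" if "\<bar>x\<bar> < R" for x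
      using *[of "of_real x"] that by (simp add: g_def a)
    then show False using nontrivial by blast
  qed
  obtain k s m where m0: "0 < m" and s: "0 < s" "ball (0::complex) s \<subseteq> ball 0 R"
    and k_hol: "k holomorphic_on ball 0 s"
    and gk': "\<And>w. w \<in> ball 0 s \<Longrightarrow> g w = (w - 0) ^ m * k w"
    and k_nz: "\<And>w. w \<in> ball 0 s \<Longrightarrow> k w \<noteq> 0"
    by (rule holomorphic_factor_zero_nonconstant[OF g_hol open_ball connected_ball R0 g0 nonconst], rule that)
  have gk: "g w = w ^ m * k w" if "w \<in> ball 0 s" for w using gk'[OF that] by simp
  have s0: "(0::complex) \<in> ball 0 s" using s by simp
  define k1 where "k1 = deriv k"
  define k2 where "k2 = deriv k1"
  have k1_hol: "k1 holomorphic_on ball 0 s" unfolding k1_def by (intro holomorphic_deriv k_hol) auto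
  have k2_hol: "k2 holomorphic_on ball 0 s" unfolding k2_def by (intro holomorphic_deriv k1_hol) auto
  have dk: "(k has_field_derivative k1 z) (at z)" if "z \<in> ball 0 s" for z
    unfolding k1_def by (rule holomorphic_derivI[OF k_hol open_ball that])
  have dk1: "(k1 has_field_derivative k2 z) (at z)" if "z \<in> ball 0 s" for z
    unfolding k2_def by (rule holomorphic_derivI[OF k1_hol open_ball that])
  have "m \<noteq> 1"
  proof
    assume "m = 1"
    have "((\<lambda>w. w * k w) has_field_derivative k 0) (at 0)"
      using dk[OF s0] by (auto intro!: derivative_eq_intros)
    then have "(g has_field_derivative k 0) (at 0)"
      by (rule has_field_derivative_transform_within_open[OF _ open_ball s0]) (use gk \<open>m = 1\<close> in simp)
    moreover have "(g has_field_derivative 0) (at 0)"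
      unfolding g_def using dh by (auto intro!: derivative_eq_intros)
    ultimately show False using DERIV_unique k_nz[OF s0] by blast
  qed
  then have m: "m \<ge> 2" using m0 by simp
  then obtain q where q: "m = Suc (Suc q)" by (metis add_2_eq_Suc le_Suc_ex)
  have sub: "cball 0 (s / 2) \<subseteq> (ball 0 s :: complex set)" using s by auto
  have bd: "\<exists>B>0. \<forall>z\<in>cball 0 (s / 2). cmod (f z) \<le> B" if "f holomorphic_on ball 0 s" for f
    using compact_imp_bounded[OF compact_continuous_image[OF
        continuous_on_subset[OF holomorphic_on_imp_continuous_on[OF that] sub] compact_cball]]
    unfolding bounded_pos by blast
  obtain B0 B1 B2 where B012: "B0 > 0" "B1 > 0" "B2 > 0"
    "\<And>z. z \<in> cball 0 (s / 2) \<Longrightarrow> cmod (k z) \<le> B0 \<and> cmod (k1 z) \<le> B1 \<and> cmod (k2 z) \<le> B2"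
    using bd[OF k_hol] bd[OF k1_hol] bd[OF k2_hol] by blast
  define B where "B = B0 + B1 + B2"
  have B: "B > 0" "\<And>z. cmod z \<le> s / 2 \<Longrightarrow> cmod (k z) \<le> B"
    "\<And>z. cmod z \<le> s / 2 \<Longrightarrow> cmod (k1 z) \<le> B" "\<And>z. cmod z \<le> s / 2 \<Longrightarrow> cmod (k2 z) \<le> B"
    using B012 unfolding B_def by (force simp: add_increasing add_increasing2)+
  have lip: "cmod (k z - k 0) \<le> B * cmod z" if "cmod z \<le> s / 2" for z
  proof -
    have "cmod (k z - k 0) \<le> B * cmod (z - 0)"
    proof (rule field_differentiable_bound[of "cball 0 (s / 2)" k k1])
      show "(k has_field_derivative k1 z) (at z within cball 0 (s / 2))" if "z \<in> cball 0 (s / 2)" for z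
        using dk sub that by (blast intro: DERIV_subset)
    qed (use B that s in auto)
    then show ?thesis by simp
  qed
  define \<kappa> where "\<kappa> = cmod (k 0)"
  have \<kappa>: "\<kappa> > 0" using k_nz[OF s0] by (simp add: \<kappa>_def)
  \<comment> \<open>This radius makes $u k'(u)$ and $k(u) - k(0)$ at most a quarter of $|k(0)|$.\<close>
  define r where "r = min (s / 2) (min 1 (\<kappa> / (4 * B)))"
  have r: "r > 0" "r \<le> s / 2" "r \<le> 1" "B * r \<le> \<kappa> / 4"
  proof -
    show "r > 0" "r \<le> s / 2" "r \<le> 1" using s \<kappa> B(1) by (auto simp: r_def)
    have "B * r \<le> B * (\<kappa> / (4 * B))" using B(1) by (intro mult_left_mono) (auto simp: r_def)
    then show "B * r \<le> \<kappa> / 4" using B(1) by simp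
  qed
  define C where "C = (real m + 1)\<^sup>2 * B"
  define G where "G = (\<lambda>z. z ^ m * k z)"
  define G1 where "G1 = (\<lambda>z. z ^ (m - 1) * (of_nat m * k z + z * k1 z))"
  define G2 where "G2 = (\<lambda>z. z ^ (m - 2) * (of_nat m * of_nat (m - 1) * k z + 2 * of_nat m * z * k1 z + z\<^sup>2 * k2 z))"
  have in_ball: "complex_of_real u \<in> ball 0 s" if "\<bar>u\<bar> \<le> r" for u using that r s by simp
  have dG: "(G has_field_derivative G1 z) (at z)" if "z \<in> ball 0 s" for z
  proof -
    have "(G has_field_derivative of_nat m * z ^ (m - 1) * k z + z ^ m * k1 z) (at z)"
      unfolding G_def using dk[OF that] by (auto intro!: derivative_eq_intros)
    also have "of_nat m * z ^ (m - 1) * k z + z ^ m * k1 z = G1 z"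
      unfolding G1_def q by (simp add: algebra_simps)
    finally show ?thesis .
  qed
  have dG1: "(G1 has_field_derivative G2 z) (at z)" if "z \<in> ball 0 s" for z
  proof -
    have "((\<lambda>z. z ^ Suc q) has_field_derivative of_nat (Suc q) * z ^ q) (at z)"
      using DERIV_power_Suc[OF DERIV_ident, of q] by simp
    moreover have "((\<lambda>z. of_nat m * k z + z * k1 z) has_field_derivative of_nat m * k1 z + (k1 z + z * k2 z)) (at z)"
      using dk[OF that] dk1[OF that] by (auto intro!: derivative_eq_intros)
    ultimately have "(G1 has_field_derivative of_nat (Suc q) * z ^ q * (of_nat m * k z + z * k1 z)
        + (of_nat m * k1 z + (k1 z + z * k2 z)) * z ^ Suc q) (at z)"
      unfolding G1_def q diff_Suc_1 by (rule DERIV_mult)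
    also have "of_nat (Suc q) * z ^ q * (of_nat m * k z + z * k1 z)
        + (of_nat m * k1 z + (k1 z + z * k2 z)) * z ^ Suc q = G2 z"
      unfolding G2_def q by (simp add: algebra_simps power2_eq_square)
    finally show ?thesis .
  qed
  have Gh: "h (of_real x) = \<i> * of_real \<alpha> * of_real x + G (of_real x)" if "\<bar>x\<bar> \<le> r" for x
    using gk[OF in_ball[OF that]] by (simp add: g_def G_def a diff_eq_eq add.commute)
  have rR: "r < R"
  proof -
    have "complex_of_real r \<in> ball 0 s" using r s by simp
    then have "complex_of_real r \<in> ball 0 R" using s by blast
    then show ?thesis using r by simp
  qed
  have "degenerate_phase m (- k 0) r \<kappa> C (\<lambda>u. G (of_real u)) (\<lambda>u. G1 (of_real u)) (\<lambda>u. G2 (of_real u))"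
  proof
    fix u :: real assume u: "\<bar>u\<bar> \<le> r"
    have us: "cmod (of_real u) \<le> s / 2" and u1: "\<bar>u\<bar> \<le> 1" using u r by auto
    note uB = B(2-4)[OF us]
    show "((\<lambda>u. G (of_real u)) has_vector_derivative G1 (of_real u)) (at u)"
      by (rule has_vector_derivative_real_field[OF dG[OF in_ball[OF u]]])
    show "((\<lambda>u. G1 (of_real u)) has_vector_derivative G2 (of_real u)) (at u)"
      by (rule has_vector_derivative_real_field[OF dG1[OF in_ball[OF u]]])
    show "Re (G (of_real u)) \<le> 0" using Re_h[of u] Gh[OF u] u rR by simp
    have uk1: "cmod (of_real u * k1 (of_real u)) \<le> B * \<bar>u\<bar>"
      using mult_left_mono[OF uB(2), of "\<bar>u\<bar>"] by (simp add: norm_mult mult.commute)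
    have Bu: "B * \<bar>u\<bar> \<le> \<kappa> / 4" "B * \<bar>u\<bar> \<le> B"
      using mult_left_mono[OF u, of B] mult_left_mono[OF u1, of B] B(1) r(4) by linarith+
    have "3 / 4 * \<kappa> \<le> cmod (k (of_real u))"
      using lip[OF us] Bu norm_triangle_ineq3[of "k (of_real u)" "k 0"] by (simp add: \<kappa>_def)
    then have "real m * (3 / 4 * \<kappa>) \<le> cmod (of_nat m * k (of_real u))"
      unfolding norm_mult norm_of_nat by (intro mult_left_mono) auto
    moreover have "2 * (3 / 4 * \<kappa>) \<le> real m * (3 / 4 * \<kappa>)" using m \<kappa> by (intro mult_right_mono) auto
    moreover have "cmod (of_nat m * k (of_real u)) - cmod (of_real u * k1 (of_real u))
        \<le> cmod (of_nat m * k (of_real u) + of_real u * k1 (of_real u))"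
      by (rule norm_diff_ineq)
    ultimately have "\<kappa> \<le> cmod (of_nat m * k (of_real u) + of_real u * k1 (of_real u))"
      using uk1 Bu \<kappa> by linarith
    from mult_right_mono[OF this, of "\<bar>u\<bar> ^ (m - 1)"]
    show "\<kappa> * \<bar>u\<bar> ^ (m - 1) \<le> cmod (G1 (of_real u))"
      by (simp add: G1_def norm_mult norm_power mult.commute)
    have mB: "real m * B + B \<le> C"
    proof -
      have "(real m + 1) * 1 \<le> (real m + 1) * (real m + 1)" by (intro mult_left_mono) auto
      from mult_right_mono[OF this, of B] B(1) show ?thesis by (simp add: C_def power2_eq_square algebra_simps)
    qed
    have "cmod (of_nat m * k (of_real u) + of_real u * k1 (of_real u)) \<le> real m * B + B"
    proof (rule order_trans[OF norm_triangle_ineq add_mono])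
      show "cmod (of_nat m * k (of_real u)) \<le> real m * B" using uB by (simp add: norm_mult mult_left_mono)
    qed (use uk1 Bu in linarith)
    then have "cmod (of_nat m * k (of_real u) + of_real u * k1 (of_real u)) \<le> C" using mB by linarith
    from mult_right_mono[OF this, of "\<bar>u\<bar> ^ (m - 1)"]
    show "cmod (G1 (of_real u)) \<le> C * \<bar>u\<bar> ^ (m - 1)"
      by (simp add: G1_def norm_mult norm_power mult.commute)
    have "cmod (of_nat m * of_nat (m - 1) * k (of_real u) + 2 * of_nat m * of_real u * k1 (of_real u)
        + (of_real u)\<^sup>2 * k2 (of_real u)) \<le> real m * real m * B + 2 * real m * B + B"
    proof (intro order_trans[OF norm_triangle_ineq] add_mono)
      have "real m * real (m - 1) * cmod (k (of_real u)) \<le> real m * real m * B"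
        using uB B(1) by (intro mult_mono) auto
      then show "cmod (of_nat m * of_nat (m - 1) * k (of_real u)) \<le> real m * real m * B"
        by (simp only: norm_mult norm_of_nat)
      have "real m * cmod (of_real u * k1 (of_real u)) \<le> real m * B" using uk1 Bu by (intro mult_left_mono) auto
      then show "cmod (2 * of_nat m * of_real u * k1 (of_real u)) \<le> 2 * real m * B"
        by (simp add: norm_mult)
      have "\<bar>u\<bar>\<^sup>2 * cmod (k2 (of_real u)) \<le> 1 * B" using uB B(1) u1 by (intro mult_mono power_le_one) auto
      then show "cmod ((of_real u)\<^sup>2 * k2 (of_real u)) \<le> B" by (simp add: norm_mult norm_power)
    qed
    also have "\<dots> = C" by (simp add: C_def power2_eq_square algebra_simps)
    finally have "cmod (of_nat m * of_nat (m - 1) * k (of_real u) + 2 * of_nat m * of_real u * k1 (of_real u)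
        + (of_real u)\<^sup>2 * k2 (of_real u)) \<le> C" .
    from mult_right_mono[OF this, of "\<bar>u\<bar> ^ (m - 2)"]
    show "cmod (G2 (of_real u)) \<le> C * \<bar>u\<bar> ^ (m - 2)"
      unfolding G2_def norm_mult[of "of_real u ^ (m - 2)"] by (simp add: norm_power mult.commute)
    have "G (of_real u) + - k 0 * of_real u ^ m = of_real u ^ m * (k (of_real u) - k 0)"
      by (simp add: G_def algebra_simps)
    also have "cmod \<dots> \<le> \<bar>u\<bar> ^ m * (B * \<bar>u\<bar>)"
      using lip[OF us] by (simp add: norm_mult norm_power mult_left_mono)
    also have "\<dots> = B * \<bar>u\<bar> ^ (m + 1)" by simp
    also have "\<dots> \<le> C * \<bar>u\<bar> ^ (m + 1)"
    proof (rule mult_right_mono)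
      show "B \<le> C" using mB B(1) by (smt (verit) mult_nonneg_nonneg of_nat_0_le_iff)
    qed simp
    finally show "cmod (G (of_real u) + - k 0 * of_real u ^ m) \<le> C * \<bar>u\<bar> ^ (m + 1)" .
  next
    have "continuous_on (ball 0 s) G2"
      unfolding G2_def by (intro continuous_intros holomorphic_on_imp_continuous_on k_hol k1_hol k2_hol)
    then show "continuous_on {-r..r} (\<lambda>u. G2 (of_real u))"
      by (rule continuous_on_compose2) (use in_ball in \<open>auto intro!: continuous_intros\<close>)
  qed (use m r \<kappa> B(1) in \<open>auto simp: C_def\<close>)
  then show ?thesis using that[OF _ _ rR Gh] k_nz[OF s0] by simp
qed

text \<open>The function $h$ of the previous lemma is $\log(\hat\phi(p+z)/\hat\phi(p))$, with $\hat\phi$ extended to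
  complex arguments.  If $\Re h$ vanished on a real interval, there would be infinitely many unimodular
  points.\<close>

lemma unimodular_point_phase:
  assumes adm: "admissible_support \<phi>" and le1: "\<And>t. cmod (fourier \<phi> t) \<le> 1"
    and p: "p \<in> unimodular_points \<phi>"
  obtains m \<alpha> \<beta> r c C \<Gamma> \<Gamma>1 \<Gamma>2 where "degenerate_phase m \<beta> r c C \<Gamma> \<Gamma>1 \<Gamma>2"
    and "log_expansion \<phi> p m \<alpha> \<beta>"
    and "\<And>x. \<bar>x\<bar> \<le> r \<Longrightarrow> fourier \<phi> (p + x) = fourier \<phi> p * exp (\<i> * of_real \<alpha> * of_real x + \<Gamma> x)"
proof -
  have fin: "finite {x. \<phi> x \<noteq> 0}" using adm by (simp add: admissible_support_def)
  have p1: "cmod (fourier \<phi> p) = 1" and p_pi: "-pi < p" "p \<le> pi"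
    using p by (auto simp: unimodular_points_def)
  then have p0: "fourier \<phi> p \<noteq> 0" by auto
  define E where "E = (\<lambda>z. (\<Sum>x | \<phi> x \<noteq> 0. \<phi> x * exp (\<i> * of_int x * (of_real p + z))) / fourier \<phi> p)"
  have E_real: "E (of_real x) = fourier \<phi> (p + x) / fourier \<phi> p" for x
    by (simp add: E_def fourier_eq_sum[OF fin])
  have E_hol: "E holomorphic_on UNIV" unfolding E_def by (intro holomorphic_intros) (use p0 in auto)
  have "isCont E 0" using holomorphic_on_imp_continuous_on[OF E_hol] continuous_on_eq_continuous_at[OF open_UNIV] by blast
  moreover have E0: "E 0 = 1" using E_real[of 0] p0 by simp
  ultimately obtain R where R: "R > 0" and ER: "\<And>z. cmod z < R \<Longrightarrow> cmod (E z - 1) < 1"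
    unfolding continuous_at_eps_delta dist_norm by (metis diff_zero zero_less_one)
  have slit: "E z \<notin> \<real>\<^sub>\<le>\<^sub>0" if "z \<in> ball 0 R" for z
  proof -
    have "cmod (E z - 1) < 1" using ER that by simp
    then have "\<bar>Re (E z - 1)\<bar> < 1" by (rule order_le_less_trans[OF abs_Re_le_cmod])
    then show ?thesis by (auto simp: complex_nonpos_Reals_iff)
  qed
  define h where "h = (\<lambda>z. Ln (E z))"
  have h_hol: "h holomorphic_on ball 0 R"
    unfolding h_def by (intro holomorphic_intros holomorphic_on_subset[OF E_hol] slit) auto
  have exp_h: "exp (h z) = E z" if "z \<in> ball 0 R" for z
    unfolding h_def using slit[OF that] by (intro exp_Ln) auto
  have norm_E: "exp (Re (h (of_real x))) = cmod (fourier \<phi> (p + x))" if "\<bar>x\<bar> < R" for x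
    using arg_cong[OF exp_h[of "of_real x"], of cmod] that p1 by (simp add: E_real norm_divide)
  have Re_h: "Re (h (of_real x)) \<le> 0" if "\<bar>x\<bar> < R" for x
    using norm_E[OF that] le1[of "p + x"] by (metis exp_le_one_iff)
  have nontrivial: "\<exists>x. \<bar>x\<bar> < R \<and> Re (h (of_real x)) \<noteq> 0"
  proof (rule ccontr)
    assume "\<not> ?thesis"
    then have *: "cmod (fourier \<phi> (p + x)) = 1" if "\<bar>x\<bar> < R" for x
      using norm_E[OF that] that by simp
    have "{max (p - R) (- pi)<..<p} \<subseteq> unimodular_points \<phi>"
    proof
      fix t assume t: "t \<in> {max (p - R) (- pi)<..<p}"
      then have "cmod (fourier \<phi> t) = 1" using *[of "t - p"] by simp
      then show "t \<in> unimodular_points \<phi>" using t p_pi by (simp add: unimodular_points_def)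
    qed
    then have "finite {max (p - R) (- pi)<..<p}" using finite_unimodular_points[OF adm] finite_subset by blast
    then show False using R p_pi by (simp add: infinite_Ioo)
  qed
  have h0: "h 0 = 0" by (simp add: h_def E0)
  obtain m \<alpha> \<beta> r c C \<Gamma> \<Gamma>1 \<Gamma>2 where phase: "degenerate_phase m \<beta> r c C \<Gamma> \<Gamma>1 \<Gamma>2" and \<beta>: "\<beta> \<noteq> 0" and rR: "r < R"
    and h: "\<And>x. \<bar>x\<bar> \<le> r \<Longrightarrow> h (of_real x) = \<i> * of_real \<alpha> * of_real x + \<Gamma> x"
    by (rule analytic_phase[OF h_hol R h0 _ nontrivial], erule Re_h, rule that)
  interpret degenerate_phase m \<beta> r c C \<Gamma> \<Gamma>1 \<Gamma>2 by (rule phase)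
  have "(\<lambda>\<xi>. Ln (fourier \<phi> (\<xi> + p) / fourier \<phi> p)
            - (\<i> * of_real \<alpha> * of_real \<xi> - \<beta> * of_real \<xi> ^ m)) \<in> o[at 0](\<lambda>\<xi>. of_real \<xi> ^ m)"
  proof (rule landau_o.smallI)
    fix \<epsilon> :: real assume \<epsilon>: "\<epsilon> > 0"
    have "\<forall>\<^sub>F \<xi>::real in at 0. \<bar>\<xi>\<bar> < min r (\<epsilon> / (C + 1))"
      using r \<epsilon> C by (auto simp: eventually_at dist_real_def intro!: exI[of _ "min r (\<epsilon> / (C + 1))"])
    then show "\<forall>\<^sub>F \<xi> in at 0. cmod (Ln (fourier \<phi> (\<xi> + p) / fourier \<phi> p)
            - (\<i> * of_real \<alpha> * of_real \<xi> - \<beta> * of_real \<xi> ^ m)) \<le> \<epsilon> * cmod (of_real \<xi> ^ m)"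
    proof eventually_elim
      case (elim \<xi>)
      then have x: "\<bar>\<xi>\<bar> \<le> r" and "\<bar>\<xi>\<bar> \<le> \<epsilon> / (C + 1)" by auto
      then have "(C + 1) * \<bar>\<xi>\<bar> \<le> \<epsilon>" using C by (simp add: field_simps)
      then have Cx: "C * \<bar>\<xi>\<bar> \<le> \<epsilon>" by (simp add: algebra_simps)
      have "Ln (fourier \<phi> (\<xi> + p) / fourier \<phi> p) - (\<i> * of_real \<alpha> * of_real \<xi> - \<beta> * of_real \<xi> ^ m)
          = \<Gamma> \<xi> + \<beta> * of_real \<xi> ^ m"
        using h[OF x] by (simp add: h_def E_real add.commute)
      also have "cmod \<dots> \<le> C * \<bar>\<xi>\<bar> ^ (m + 1)" by (rule approx[OF x])
      also have "\<dots> = (C * \<bar>\<xi>\<bar>) * \<bar>\<xi>\<bar> ^ m" by simp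
      also have "\<dots> \<le> \<epsilon> * \<bar>\<xi>\<bar> ^ m" using Cx by (intro mult_right_mono) auto
      finally show ?case by (simp add: norm_power)
    qed
  qed
  then have "log_expansion \<phi> p m \<alpha> \<beta>" using m \<beta> Re_coeff by (auto simp: log_expansion_def)
  moreover have "fourier \<phi> (p + x) = fourier \<phi> p * exp (\<i> * of_real \<alpha> * of_real x + \<Gamma> x)" if "\<bar>x\<bar> \<le> r" for x
    using exp_h[of "of_real x"] h[OF that] that rR p0 by (simp add: E_real field_simps)
  ultimately show ?thesis using that phase by blast
qed

section \<open>The local limit theorem\<close>

text \<open>The main term that the point $p$ contributes along the drift $\alpha$.\<close>

definition resonant_term :: "(int \<Rightarrow> complex) \<Rightarrow> nat \<Rightarrow> real \<Rightarrow> real \<Rightarrow> nat \<Rightarrow> int \<Rightarrow> real \<Rightarrow> complex" where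
  "resonant_term \<phi> m \<alpha> p n k x =
    (if expansion_order \<phi> p = m \<and> expansion_drift \<phi> p = \<alpha>
     then of_real (real n powr (- 1 / real m)) * exp (- \<i> * of_int k * of_real p)
        * fourier \<phi> p ^ n * attractor m (expansion_coeff \<phi> p) x
     else 0)"

text \<open>One statement for the three kinds of unimodular points.  The neighbourhood has to be small in the
  nonresonant case, depending on the difference of the drifts, and every smaller one serves as well.
  This allows a common $\delta$ for all points.\<close>

lemma point_contribution:
  fixes \<alpha> :: real
  assumes adm: "admissible_support \<phi>" and le1: "\<And>t. cmod (fourier \<phi> t) \<le> 1"
    and p: "p \<in> unimodular_points \<phi>" and order: "expansion_order \<phi> p \<le> m" and X: "X \<ge> 0"
  shows "\<forall>\<^sub>F \<delta> in at_right 0. \<forall>\<epsilon>>0. \<forall>\<^sub>F n in sequentially. \<forall>x (k::int).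
    \<bar>x\<bar> \<le> X \<longrightarrow> \<bar>(of_int k - \<alpha> * n) * real n powr (- 1 / real m) - x\<bar> \<le> real n powr (- 1 / real m) \<longrightarrow>
    cmod (integral {p - \<delta>..p + \<delta>} (\<lambda>\<xi>. fourier \<phi> \<xi> ^ n * exp (- \<i> * of_int k * of_real \<xi>))
      - of_real (2 * pi) * resonant_term \<phi> m \<alpha> p n k x)
    \<le> \<epsilon> * real n powr (- 1 / real m)"
proof -
  obtain mp \<alpha>p \<beta> r c C \<Gamma> \<Gamma>1 \<Gamma>2 where phase: "degenerate_phase mp \<beta> r c C \<Gamma> \<Gamma>1 \<Gamma>2"
    and log: "log_expansion \<phi> p mp \<alpha>p \<beta>"
    and F: "\<And>x. \<bar>x\<bar> \<le> r \<Longrightarrow> fourier \<phi> (p + x) = fourier \<phi> p * exp (\<i> * of_real \<alpha>p * of_real x + \<Gamma> x)"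
    using unimodular_point_phase[OF adm le1 p] by metis
  interpret degenerate_phase mp \<beta> r c C \<Gamma> \<Gamma>1 \<Gamma>2 by (rule phase)
  note ec = expansion_constants[OF log]
  have \<beta>: "\<beta> \<noteq> 0" using log by (simp add: log_expansion_def)
  have mp: "mp \<le> m" using order ec by simp
  then have m2: "m \<ge> 2" using m by simp
  have p1: "cmod (fourier \<phi> p) = 1" using p by (simp add: unimodular_points_def)
  \<comment> \<open>For different drifts the bound makes $C\delta$ at most a quarter of their distance.\<close>
  define D where "D = (if \<alpha>p = \<alpha> then r else min r (min 1 (\<bar>\<alpha> - \<alpha>p\<bar> / (4 * (C + 1)))))"
  have "D > 0" using r C by (auto simp: D_def)
  have Dr: "D \<le> r" by (simp add: D_def)
  have "\<forall>\<^sub>F \<delta> in at_right 0. 0 < \<delta> \<and> \<delta> < D"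
    using eventually_at_right_real[OF \<open>D > 0\<close>] by simp
  then show ?thesis
  proof (eventually_elim, intro allI impI)
    fix \<delta> \<epsilon> :: real assume \<delta>: "0 < \<delta> \<and> \<delta> < D" and \<epsilon>: "\<epsilon> > 0"
    then have \<delta>r: "0 < \<delta>" "\<delta> \<le> r" using Dr by auto
    have shift: "integral {p - \<delta>..p + \<delta>} (\<lambda>\<xi>. fourier \<phi> \<xi> ^ n * exp (- \<i> * of_int k * of_real \<xi>))
        = (exp (- \<i> * of_int k * of_real p) * fourier \<phi> p ^ n) * integral {-\<delta>..\<delta>} (wave n (of_int k - \<alpha>p * n))"
      for n and k :: int
    proof -
      have "integral {p - \<delta>..p + \<delta>} (\<lambda>\<xi>. fourier \<phi> \<xi> ^ n * exp (- \<i> * of_int k * of_real \<xi>))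
          = integral {-\<delta>..\<delta>} (\<lambda>u. fourier \<phi> (p + u) ^ n * exp (- \<i> * of_int k * of_real (p + u)))"
        using integral_shift_Icc_real[of "-\<delta>" \<delta> "\<lambda>\<xi>. fourier \<phi> \<xi> ^ n * exp (- \<i> * of_int k * of_real \<xi>)" p]
        by (simp add: o_def add.commute)
      also have "\<dots> = integral {-\<delta>..\<delta>} (\<lambda>u. (exp (- \<i> * of_int k * of_real p) * fourier \<phi> p ^ n) * wave n (of_int k - \<alpha>p * n) u)"
      proof (rule integral_cong)
        fix u assume "u \<in> {-\<delta>..\<delta>}"
        then have u: "\<bar>u\<bar> \<le> r" using \<delta>r by auto
        have "exp (\<i> * of_real \<alpha>p * of_real u + \<Gamma> u) ^ n * exp (- \<i> * of_int k * of_real (p + u))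
            = exp (- \<i> * of_int k * of_real p) * wave n (of_int k - \<alpha>p * n) u"
          unfolding exp_of_nat_mult[symmetric] exp_add[symmetric]
          by (rule arg_cong[where f = exp]) (simp add: algebra_simps)
        then show "fourier \<phi> (p + u) ^ n * exp (- \<i> * of_int k * of_real (p + u))
            = (exp (- \<i> * of_int k * of_real p) * fourier \<phi> p ^ n) * wave n (of_int k - \<alpha>p * n) u"
          by (simp only: F[OF u] power_mult_distrib mult_ac)
      qed
      also have "\<dots> = (exp (- \<i> * of_int k * of_real p) * fourier \<phi> p ^ n) * integral {-\<delta>..\<delta>} (wave n (of_int k - \<alpha>p * n))"
        by (rule integral_mult_right)
      finally show ?thesis .
    qed
    have unit: "cmod (exp (- \<i> * of_int k * of_real p) * fourier \<phi> p ^ n) = 1" for k :: int and n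
      using p1 by (simp add: norm_mult norm_power)
    have norm_shift: "cmod (integral {p - \<delta>..p + \<delta>} (\<lambda>\<xi>. fourier \<phi> \<xi> ^ n * exp (- \<i> * of_int k * of_real \<xi>)))
        = cmod (integral {-\<delta>..\<delta>} (wave n (of_int k - \<alpha>p * n)))" for n and k :: int
      unfolding shift by (simp only: norm_mult[of "exp _ * _"] unit mult_1)
    let ?goal = "\<lambda>n::nat. \<forall>x (k::int).
      \<bar>x\<bar> \<le> X \<longrightarrow> \<bar>(of_int k - \<alpha> * n) * real n powr (- 1 / real m) - x\<bar> \<le> real n powr (- 1 / real m) \<longrightarrow>
      cmod (integral {p - \<delta>..p + \<delta>} (\<lambda>\<xi>. fourier \<phi> \<xi> ^ n * exp (- \<i> * of_int k * of_real \<xi>))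
        - of_real (2 * pi) * resonant_term \<phi> m \<alpha> p n k x)
      \<le> \<epsilon> * real n powr (- 1 / real m)"
    have scaled: "\<bar>(of_int k - \<alpha> * n) * real n powr (- 1 / real m)\<bar> \<le> X + 1"
      if "n > 0" "\<bar>x\<bar> \<le> X" "\<bar>(of_int k - \<alpha> * n) * real n powr (- 1 / real m) - x\<bar> \<le> real n powr (- 1 / real m)"
      for n k x
    proof -
      have "real n powr (- 1 / real m) \<le> real n powr 0" using that(1) by (intro powr_mono) auto
      then have "real n powr (- 1 / real m) \<le> 1" using that(1) by simp
      then show ?thesis using that(2,3) by linarith
    qed
    consider "\<alpha>p = \<alpha>" "mp = m" | "\<alpha>p = \<alpha>" "mp < m" | "\<alpha>p \<noteq> \<alpha>" using mp by fastforce
    then show "\<forall>\<^sub>F n in sequentially. ?goal n"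
    proof cases
      case 1
      from resonant_asymptotics[OF \<beta> \<delta>r X \<epsilon>] show ?thesis
      proof eventually_elim
        case (elim n)
        show ?case
        proof (intro allI impI)
          fix x and k :: int
          define t where "t = real n powr (- 1 / real m)"
          define w where "w = exp (- \<i> * of_int k * of_real p) * fourier \<phi> p ^ n"
          assume x: "\<bar>x\<bar> \<le> X" "\<bar>(of_int k - \<alpha> * n) * real n powr (- 1 / real m) - x\<bar> \<le> real n powr (- 1 / real m)"
          have "integral {p - \<delta>..p + \<delta>} (\<lambda>\<xi>. fourier \<phi> \<xi> ^ n * exp (- \<i> * of_int k * of_real \<xi>))
            - of_real (2 * pi) * (of_real t * exp (- \<i> * of_int k * of_real p) * fourier \<phi> p ^ n * attractor m \<beta> x)
            = w * (integral {-\<delta>..\<delta>} (wave n (of_int k - \<alpha> * n)) - of_real t * (of_real (2 * pi) * attractor m \<beta> x))"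
            unfolding shift 1 w_def by (simp only: right_diff_distrib mult_ac)
          moreover have "cmod w = 1" unfolding w_def by (rule unit)
          moreover have "cmod (integral {-\<delta>..\<delta>} (wave n (of_int k - \<alpha> * n)) - of_real t * (of_real (2 * pi) * attractor m \<beta> x)) \<le> \<epsilon> * t"
            using elim x unfolding 1 t_def by blast
          ultimately show "cmod (integral {p - \<delta>..p + \<delta>} (\<lambda>\<xi>. fourier \<phi> \<xi> ^ n * exp (- \<i> * of_int k * of_real \<xi>))
            - of_real (2 * pi) * resonant_term \<phi> m \<alpha> p n k x)
            \<le> \<epsilon> * real n powr (- 1 / real m)"
            unfolding resonant_term_def t_def[symmetric] ec using 1 by (simp add: norm_mult)
        qed
      qed
    next
      case 2
      have "X + 1 \<ge> 0" using X by simp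
      from lower_order_negligible[OF \<delta>r 2(2) this \<epsilon>] eventually_gt_at_top[of 0] show ?thesis
      proof eventually_elim
        case (elim n)
        show ?case
        proof (intro allI impI)
          fix x and k :: int
          assume x: "\<bar>x\<bar> \<le> X" "\<bar>(of_int k - \<alpha> * n) * real n powr (- 1 / real m) - x\<bar> \<le> real n powr (- 1 / real m)"
          have "cmod (integral {-\<delta>..\<delta>} (wave n (of_int k - \<alpha> * n))) \<le> \<epsilon> * real n powr (- 1 / real m)"
            using elim(1) scaled[OF elim(2) x] by blast
          then show "cmod (integral {p - \<delta>..p + \<delta>} (\<lambda>\<xi>. fourier \<phi> \<xi> ^ n * exp (- \<i> * of_int k * of_real \<xi>))
            - of_real (2 * pi) * resonant_term \<phi> m \<alpha> p n k x)
            \<le> \<epsilon> * real n powr (- 1 / real m)"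
            using 2 ec norm_shift[of n k] by (simp add: resonant_term_def)
        qed
      qed
    next
      case 3
      have X1: "X + 1 \<ge> 0" using X by simp
      have g: "\<alpha> - \<alpha>p \<noteq> 0" using 3 by simp
      have \<delta>1: "\<delta> \<le> 1" "\<delta> \<le> \<bar>\<alpha> - \<alpha>p\<bar> / (4 * (C + 1))" using \<delta> 3 by (auto simp: D_def)
      have "4 * (C + 1) * \<delta> \<le> \<bar>\<alpha> - \<alpha>p\<bar>" using \<delta>1(2) C by (simp add: field_simps)
      then have \<delta>C: "C * \<delta> \<le> \<bar>\<alpha> - \<alpha>p\<bar> / 4" using \<delta>r by (simp add: algebra_simps)
      from nonresonant_negligible[OF m2 g X1 \<epsilon> \<delta>r \<delta>1(1) \<delta>C] eventually_gt_at_top[of 0] show ?thesis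
      proof eventually_elim
        case (elim n)
        show ?case
        proof (intro allI impI)
          fix x and k :: int
          assume x: "\<bar>x\<bar> \<le> X" "\<bar>(of_int k - \<alpha> * n) * real n powr (- 1 / real m) - x\<bar> \<le> real n powr (- 1 / real m)"
          have eq: "of_int k - \<alpha>p * n - (\<alpha> - \<alpha>p) * n = of_int k - \<alpha> * n" by (simp add: algebra_simps)
          have "\<bar>(of_int k - \<alpha>p * n - (\<alpha> - \<alpha>p) * n) * real n powr (- 1 / real m)\<bar> \<le> X + 1"
            unfolding eq by (rule scaled[OF elim(2) x])
          then have "cmod (integral {-\<delta>..\<delta>} (wave n (of_int k - \<alpha>p * n))) \<le> \<epsilon> * real n powr (- 1 / real m)"
            using elim(1) by blast
          then show "cmod (integral {p - \<delta>..p + \<delta>} (\<lambda>\<xi>. fourier \<phi> \<xi> ^ n * exp (- \<i> * of_int k * of_real \<xi>))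
            - of_real (2 * pi) * resonant_term \<phi> m \<alpha> p n k x)
            \<le> \<epsilon> * real n powr (- 1 / real m)"
            using 3 ec norm_shift[of n k] by (simp add: resonant_term_def)
        qed
      qed
    qed
  qed
qed

text \<open>The period without the open neighbourhoods is compact, so $|\hat\phi|$ is bounded by some $\rho < 1$ there.\<close>

lemma conv_power_localize:
  assumes fin: "finite {x. \<phi> x \<noteq> 0}" and P: "finite P" and \<delta>: "\<delta> > 0"
    and inside: "\<And>p. p \<in> P \<Longrightarrow> \<theta> \<le> p - \<delta> \<and> p + \<delta> \<le> \<theta> + 2 * pi"
    and apart: "\<And>p p'. \<lbrakk>p \<in> P; p' \<in> P; p \<noteq> p'\<rbrakk> \<Longrightarrow> 2 * \<delta> < \<bar>p - p'\<bar>"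
    and less1: "\<And>\<xi>. \<lbrakk>\<theta> \<le> \<xi>; \<xi> \<le> \<theta> + 2 * pi; \<xi> \<notin> P\<rbrakk> \<Longrightarrow> cmod (fourier \<phi> \<xi>) < 1"
  shows "\<exists>\<rho>. 0 \<le> \<rho> \<and> \<rho> < 1 \<and> (\<forall>n k. cmod (of_real (2 * pi) * conv_power \<phi> n k -
    (\<Sum>p\<in>P. integral {p - \<delta>..p + \<delta>} (\<lambda>\<xi>. fourier \<phi> \<xi> ^ n * exp (- \<i> * of_int k * of_real \<xi>))))
    \<le> \<rho> ^ n * (2 * pi))"
proof -
  define I where "I = {\<theta>..\<theta> + 2 * pi}"
  define E where "E = I - (\<Union>p\<in>P. ball p \<delta>)"
  have "compact E" unfolding E_def I_def by (intro compact_diff compact_Icc) auto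
  obtain \<rho> where \<rho>: "0 \<le> \<rho>" "\<rho> < 1" "\<And>\<xi>. \<xi> \<in> E \<Longrightarrow> cmod (fourier \<phi> \<xi>) \<le> \<rho>"
  proof (cases "E = {}")
    case True
    then show ?thesis using that[of 0] by simp
  next
    case False
    obtain x where x: "x \<in> E" "\<forall>y\<in>E. cmod (fourier \<phi> y) \<le> cmod (fourier \<phi> x)"
      using continuous_attains_sup[OF \<open>compact E\<close> False, of "\<lambda>\<xi>. cmod (fourier \<phi> \<xi>)"]
        fourier_continuous[OF fin] by (auto intro: continuous_on_norm)
    have "x \<notin> P" using x(1) \<delta> by (auto simp: E_def)
    then have "cmod (fourier \<phi> x) < 1" using x(1) by (intro less1) (auto simp: E_def I_def)
    then show ?thesis using that[of "cmod (fourier \<phi> x)"] x(2) by simp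
  qed
  show ?thesis
  proof (intro exI conjI allI)
    fix n and k :: int
    let ?f = "\<lambda>\<xi>. fourier \<phi> \<xi> ^ n * exp (- \<i> * of_int k * of_real \<xi>)"
    define T where "T = (\<Union>p\<in>P. {p - \<delta>..p + \<delta>})"
    have int: "?f integrable_on {a..b}" for a b
      by (intro integrable_continuous_real continuous_intros fourier_continuous fin)
    have "(?f has_integral (\<Sum>p\<in>P. integral {p - \<delta>..p + \<delta>} ?f)) T"
      unfolding T_def
    proof (rule has_integral_UN[OF P])
      show "(?f has_integral integral {p - \<delta>..p + \<delta>} ?f) {p - \<delta>..p + \<delta>}" for p
        by (rule integrable_integral[OF int])
      show "pairwise (\<lambda>p p'. negligible ({p - \<delta>..p + \<delta>} \<inter> {p' - \<delta>..p' + \<delta>})) P"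
      proof (rule pairwiseI)
        fix p p' assume "p \<in> P" "p' \<in> P" "p \<noteq> p'"
        then have "{p - \<delta>..p + \<delta>} \<inter> {p' - \<delta>..p' + \<delta>} = {}" using apart[of p p'] by auto
        then show "negligible ({p - \<delta>..p + \<delta>} \<inter> {p' - \<delta>..p' + \<delta>})" by simp
      qed
    qed
    moreover have TI: "T \<subseteq> I" using inside by (fastforce simp: T_def I_def)
    ultimately have "(?f has_integral of_real (2 * pi) * conv_power \<phi> n k - (\<Sum>p\<in>P. integral {p - \<delta>..p + \<delta>} ?f)) (I - T)"
      using conv_power_fourier[OF fin, of n k \<theta>] unfolding I_def by (intro has_integral_setdiff) auto
    then have "((\<lambda>\<xi>. if \<xi> \<in> I - T then ?f \<xi> else 0) has_integral
        of_real (2 * pi) * conv_power \<phi> n k - (\<Sum>p\<in>P. integral {p - \<delta>..p + \<delta>} ?f)) (cbox \<theta> (\<theta> + 2 * pi))"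
      by (subst has_integral_restrict) (auto simp: I_def)
    then have "cmod (of_real (2 * pi) * conv_power \<phi> n k - (\<Sum>p\<in>P. integral {p - \<delta>..p + \<delta>} ?f))
        \<le> \<rho> ^ n * measure lborel (cbox \<theta> (\<theta> + 2 * pi))"
    proof (rule has_integral_bound[rotated])
      fix \<xi>
      show "cmod (if \<xi> \<in> I - T then ?f \<xi> else 0) \<le> \<rho> ^ n"
      proof (cases "\<xi> \<in> I - T")
        case True
        then have "\<xi> \<in> E" by (auto simp: E_def T_def dist_real_def)
        then show ?thesis using True \<rho> by (simp add: norm_mult norm_power power_mono)
      next
        case False
        then show ?thesis using \<rho> by (simp only: if_False norm_zero zero_le_power)
      qed
    qed (use \<rho> in simp)
    then show "cmod (of_real (2 * pi) * conv_power \<phi> n k - (\<Sum>p\<in>P. integral {p - \<delta>..p + \<delta>} ?f)) \<le> \<rho> ^ n * (2 * pi)"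
      by simp
  qed (use \<rho> in auto)
qed

theorem theorem1p3:
  fixes \<phi> :: "int \<Rightarrow> complex" and m R :: nat
    and \<xi> \<alpha> :: "nat \<Rightarrow> real" and \<beta> :: "nat \<Rightarrow> complex"
  assumes "admissible_support \<phi>"
    and "(SUP t. cmod (fourier \<phi> t)) = 1"
    and "m = max_order \<phi>"
    and "bij_betw \<xi> {1..R} (max_order_points \<phi>)"
    and "\<And>q. q \<in> {1..R} \<Longrightarrow> \<alpha> q = expansion_drift \<phi> (\<xi> q)"
    and "\<And>q. q \<in> {1..R} \<Longrightarrow> \<beta> q = expansion_coeff \<phi> (\<xi> q)"
  shows "\<forall>q\<in>{1..R}. \<exists>(r::nat) (j::nat \<Rightarrow> nat).
    r \<ge> 1 \<and> inj_on j {1..r} \<and> j ` {1..r} \<subseteq> {1..R} \<and>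
    (\<forall>K::real set. compact K \<longrightarrow>
      (\<forall>\<epsilon>>0. \<forall>\<^sub>F n in sequentially. \<forall>x\<in>K.
         let k = \<lfloor>\<alpha> q * real n + x * real n powr (1 / real m)\<rfloor> in
         cmod (conv_power \<phi> n k -
               (\<Sum>l = 1..r. of_real (real n powr (- 1 / real m))
                  * exp (- \<i> * of_int k * of_real (\<xi> (j l)))
                  * fourier \<phi> (\<xi> (j l)) ^ n * attractor m (\<beta> (j l)) x))
         \<le> \<epsilon> * real n powr (- 1 / real m)))"
proof
  fix q assume q: "q \<in> {1..R}"
  let ?\<Omega> = "unimodular_points \<phi>"
  have fin: "finite {x. \<phi> x \<noteq> 0}" using assms(1) by (simp add: admissible_support_def)
  have le1: "cmod (fourier \<phi> t) \<le> 1" for t by (rule norm_fourier_le_1[OF fin assms(2)])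
  have fin\<Omega>: "finite ?\<Omega>" by (rule finite_unimodular_points[OF assms(1)])
  have order: "expansion_order \<phi> p \<le> m" if "p \<in> ?\<Omega>" for p
    unfolding assms(3) max_order_def using that fin\<Omega> by (intro Max_ge) auto
  have m: "m \<ge> 2"
  proof -
    have "\<xi> q \<in> max_order_points \<phi>" using bij_betw_apply[OF assms(4) q] .
    then have "\<xi> q \<in> ?\<Omega>" "expansion_order \<phi> (\<xi> q) = m" using assms(3) by (auto simp: max_order_points_def)
    then show ?thesis
      using unimodular_point_phase[OF assms(1) le1] expansion_constants(1) by (metis log_expansion_def)
  qed
  define S where "S = {i \<in> {1..R}. \<alpha> i = \<alpha> q}"
  have finS: "finite S" by (simp add: S_def)
  obtain j where j: "bij_betw j {1..card S} S" using ex_bij_betw_nat_finite_1[OF finS] by blast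
  have "card S \<ge> 1" using q finS by (auto simp: S_def Suc_le_eq card_gt_0_iff)
  have sum_S: "(\<Sum>l = 1..card S. of_real (real n powr (- 1 / real m)) * exp (- \<i> * of_int k * of_real (\<xi> (j l)))
                  * fourier \<phi> (\<xi> (j l)) ^ n * attractor m (\<beta> (j l)) x)
      = (\<Sum>p\<in>?\<Omega>. resonant_term \<phi> m (\<alpha> q) p n k x)" for n k x
  proof -
    let ?term = "\<lambda>i. of_real (real n powr (- 1 / real m)) * exp (- \<i> * of_int k * of_real (\<xi> i))
                  * fourier \<phi> (\<xi> i) ^ n * attractor m (\<beta> i) x"
    have img: "\<xi> ` {1..R} = max_order_points \<phi>" and inj: "inj_on \<xi> {1..R}"
      using assms(4) by (auto simp: bij_betw_def)
    have "(\<Sum>l = 1..card S. ?term (j l)) = (\<Sum>i\<in>S. ?term i)"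
      by (rule sum.reindex_bij_betw[OF j])
    also have "\<dots> = (\<Sum>i\<in>S. resonant_term \<phi> m (\<alpha> q) (\<xi> i) n k x)"
    proof (rule sum.cong[OF refl])
      fix i assume "i \<in> S"
      then have i: "i \<in> {1..R}" "\<alpha> i = \<alpha> q" by (auto simp: S_def)
      have "\<xi> i \<in> max_order_points \<phi>" using img i(1) by blast
      then have "expansion_order \<phi> (\<xi> i) = m" unfolding assms(3) by (simp add: max_order_points_def)
      moreover have "expansion_drift \<phi> (\<xi> i) = \<alpha> q" "expansion_coeff \<phi> (\<xi> i) = \<beta> i"
        using assms(5,6)[OF i(1)] i(2) by auto
      ultimately show "?term i = resonant_term \<phi> m (\<alpha> q) (\<xi> i) n k x"
        by (simp only: resonant_term_def simp_thms if_True)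
    qed
    also have "\<dots> = (\<Sum>p\<in>\<xi> ` S. resonant_term \<phi> m (\<alpha> q) p n k x)"
    proof -
      have "inj_on \<xi> S" using inj by (rule inj_on_subset) (auto simp: S_def)
      then show ?thesis by (simp only: sum.reindex o_def)
    qed
    also have "\<dots> = (\<Sum>p\<in>?\<Omega>. resonant_term \<phi> m (\<alpha> q) p n k x)"
    proof (rule sum.mono_neutral_left[OF fin\<Omega>])
      show "\<xi> ` S \<subseteq> ?\<Omega>" using img by (auto simp: S_def max_order_points_def)
      show "\<forall>p\<in>?\<Omega> - \<xi> ` S. resonant_term \<phi> m (\<alpha> q) p n k x = 0"
      proof
        fix p assume p: "p \<in> ?\<Omega> - \<xi> ` S"
        have "\<not> (expansion_order \<phi> p = m \<and> expansion_drift \<phi> p = \<alpha> q)"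
        proof
          assume *: "expansion_order \<phi> p = m \<and> expansion_drift \<phi> p = \<alpha> q"
          then have "p \<in> \<xi> ` {1..R}" using p assms(3) unfolding img by (auto simp: max_order_points_def)
          then obtain i where "i \<in> {1..R}" "p = \<xi> i" by blast
          then show False using p * assms(5)[of i] by (auto simp: S_def)
        qed
        then show "resonant_term \<phi> m (\<alpha> q) p n k x = 0" by (simp only: resonant_term_def if_False)
      qed
    qed
    finally show ?thesis .
  qed
  show "\<exists>(r::nat) (j::nat \<Rightarrow> nat).
    r \<ge> 1 \<and> inj_on j {1..r} \<and> j ` {1..r} \<subseteq> {1..R} \<and>
    (\<forall>K::real set. compact K \<longrightarrow>
      (\<forall>\<epsilon>>0. \<forall>\<^sub>F n in sequentially. \<forall>x\<in>K.
         let k = \<lfloor>\<alpha> q * real n + x * real n powr (1 / real m)\<rfloor> in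
         cmod (conv_power \<phi> n k -
               (\<Sum>l = 1..r. of_real (real n powr (- 1 / real m))
                  * exp (- \<i> * of_int k * of_real (\<xi> (j l)))
                  * fourier \<phi> (\<xi> (j l)) ^ n * attractor m (\<beta> (j l)) x))
         \<le> \<epsilon> * real n powr (- 1 / real m)))"
    unfolding Let_def
  proof (intro exI[of _ "card S"] exI[of _ j] conjI allI impI)
    show "1 \<le> card S" by fact
    show "inj_on j {1..card S}" "j ` {1..card S} \<subseteq> {1..R}" using j by (auto simp: bij_betw_def S_def)
    fix K :: "real set" and \<epsilon> :: real assume "compact K" and \<epsilon>: "\<epsilon> > 0"
    then obtain X where X: "X > 0" "\<And>x. x \<in> K \<Longrightarrow> \<bar>x\<bar> \<le> X"
      using compact_imp_bounded[of K] unfolding bounded_pos real_norm_def by blast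
    \<comment> \<open>A period starting strictly between $-\pi$ and the least unimodular point has all of them in its interior, even if $\pi$ is one.\<close>
    define \<mu> where "\<mu> = Min (insert pi ?\<Omega>)"
    define \<theta> where "\<theta> = (- pi + \<mu>) / 2"
    have "\<mu> \<in> insert pi ?\<Omega>" unfolding \<mu>_def using fin\<Omega> by (intro Min_in) auto
    then have \<mu>: "- pi < \<mu>" "\<mu> \<le> pi" by (auto simp: unimodular_points_def)
    then have \<theta>: "- pi < \<theta>" "\<theta> < pi" "\<theta> < \<mu>" by (auto simp: \<theta>_def)
    have \<theta>\<Omega>: "\<theta> < p \<and> p < \<theta> + 2 * pi" if "p \<in> ?\<Omega>" for p
    proof -
      have "\<mu> \<le> p" unfolding \<mu>_def using that fin\<Omega> by (intro Min_le) auto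
      moreover have "p \<le> pi" using that by (simp add: unimodular_points_def)
      ultimately show ?thesis using \<theta> by linarith
    qed
    have less1: "cmod (fourier \<phi> t) < 1" if t: "\<theta> \<le> t" "t \<le> \<theta> + 2 * pi" "t \<notin> ?\<Omega>" for t
    proof -
      have "cmod (fourier \<phi> t) \<noteq> 1"
      proof (cases "t \<le> pi")
        case True
        then show ?thesis using t \<theta> by (auto simp: unimodular_points_def)
      next
        case False
        then have "t - 2 * pi \<notin> ?\<Omega>" using \<theta>\<Omega>[of "t - 2 * pi"] t by auto
        moreover have "- pi < t - 2 * pi" "t - 2 * pi \<le> pi" using False t \<theta> by auto
        ultimately have "cmod (fourier \<phi> (t - 2 * pi)) \<noteq> 1" by (simp add: unimodular_points_def)
        then show ?thesis using fourier_periodic[OF fin, of "t - 2 * pi"] by simp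
      qed
      then show ?thesis using le1[of t] by simp
    qed
    let ?I = "\<lambda>\<delta> p n (k::int). integral {p - \<delta>..p + \<delta>} (\<lambda>\<xi>. fourier \<phi> \<xi> ^ n * exp (- \<i> * of_int k * of_real \<xi>))"
    let ?near = "\<lambda>n x (k::int). \<bar>(of_int k - \<alpha> q * real n) * real n powr (- 1 / real m) - x\<bar> \<le> real n powr (- 1 / real m)"
    let ?local = "\<lambda>\<delta> p. \<forall>\<epsilon>>0. \<forall>\<^sub>F n in sequentially. \<forall>x (k::int). \<bar>x\<bar> \<le> X \<longrightarrow> ?near n x k \<longrightarrow>
        cmod (?I \<delta> p n k - of_real (2 * pi) * resonant_term \<phi> m (\<alpha> q) p n k x) \<le> \<epsilon> * real n powr (- 1 / real m)"
    have "\<forall>\<^sub>F \<delta> in at_right 0. \<forall>p\<in>?\<Omega>. ?local \<delta> p"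
      by (intro eventually_ball_finite[OF fin\<Omega>] ballI point_contribution[OF assms(1) le1 _ order])
         (use X in auto)
    moreover have "\<forall>\<^sub>F \<delta> in at_right 0. \<forall>p\<in>?\<Omega>. \<theta> \<le> p - \<delta> \<and> p + \<delta> \<le> \<theta> + 2 * pi"
    proof (intro eventually_ball_finite[OF fin\<Omega>] ballI)
      fix p assume "p \<in> ?\<Omega>"
      then have "0 < min (p - \<theta>) (\<theta> + 2 * pi - p)" using \<theta>\<Omega>[of p] by simp
      from eventually_at_right_real[OF this]
      show "\<forall>\<^sub>F \<delta> in at_right 0. \<theta> \<le> p - \<delta> \<and> p + \<delta> \<le> \<theta> + 2 * pi"
        by (rule eventually_mono) auto
    qed
    moreover have "\<forall>\<^sub>F \<delta> in at_right 0. \<forall>p\<in>?\<Omega>. \<forall>p'\<in>?\<Omega>. p \<noteq> p' \<longrightarrow> 2 * \<delta> < \<bar>p - p'\<bar>"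
    proof (intro eventually_ball_finite[OF fin\<Omega>] ballI)
      fix p p' :: real
      show "\<forall>\<^sub>F \<delta> in at_right 0. p \<noteq> p' \<longrightarrow> 2 * \<delta> < \<bar>p - p'\<bar>"
      proof (cases "p = p'")
        case False
        then have "0 < \<bar>p - p'\<bar> / 2" by simp
        from eventually_at_right_real[OF this] show ?thesis by (rule eventually_mono) auto
      qed simp
    qed
    moreover have "\<forall>\<^sub>F \<delta>::real in at_right 0. \<delta> > 0" by (rule eventually_at_right_less)
    ultimately have "\<forall>\<^sub>F \<delta> in at_right 0. (\<forall>p\<in>?\<Omega>. ?local \<delta> p) \<and> (\<forall>p\<in>?\<Omega>. \<theta> \<le> p - \<delta> \<and> p + \<delta> \<le> \<theta> + 2 * pi)
        \<and> (\<forall>p\<in>?\<Omega>. \<forall>p'\<in>?\<Omega>. p \<noteq> p' \<longrightarrow> 2 * \<delta> < \<bar>p - p'\<bar>) \<and> \<delta> > 0"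
      by (intro eventually_conj)
    from eventually_happens'[OF trivial_limit_at_right_real this] obtain \<delta> where local: "\<And>p. p \<in> ?\<Omega> \<Longrightarrow> ?local \<delta> p"
      and inside: "\<And>p. p \<in> ?\<Omega> \<Longrightarrow> \<theta> \<le> p - \<delta> \<and> p + \<delta> \<le> \<theta> + 2 * pi"
      and apart: "\<And>p p'. \<lbrakk>p \<in> ?\<Omega>; p' \<in> ?\<Omega>; p \<noteq> p'\<rbrakk> \<Longrightarrow> 2 * \<delta> < \<bar>p - p'\<bar>" and \<delta>: "\<delta> > 0"
      by blast
    obtain \<rho> where \<rho>: "0 \<le> \<rho>" "\<rho> < 1"
      and far: "\<And>n k. cmod (of_real (2 * pi) * conv_power \<phi> n k - (\<Sum>p\<in>?\<Omega>. ?I \<delta> p n k)) \<le> \<rho> ^ n * (2 * pi)"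
      using conv_power_localize[OF fin fin\<Omega> \<delta> inside apart less1] by blast
    \<comment> \<open>One share of the error for each unimodular point and one for the rest of the period.\<close>
    define \<eta> where "\<eta> = \<epsilon> / (real (card ?\<Omega>) + 1)"
    have \<eta>: "\<eta> > 0" using \<epsilon> by (simp add: \<eta>_def)
    have "\<forall>\<^sub>F n in sequentially. \<forall>p\<in>?\<Omega>. \<forall>x (k::int). \<bar>x\<bar> \<le> X \<longrightarrow> ?near n x k \<longrightarrow>
        cmod (?I \<delta> p n k - of_real (2 * pi) * resonant_term \<phi> m (\<alpha> q) p n k x) \<le> \<eta> * real n powr (- 1 / real m)"
      using local \<eta> by (intro eventually_ball_finite[OF fin\<Omega>]) blast
    moreover have "\<forall>\<^sub>F n in sequentially. 1 * (real n * \<rho> ^ n) \<le> \<eta>"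
      using powser_times_n_limit_0[of \<rho>] \<rho> \<eta> by (intro eventually_mult_le) auto
    ultimately show "\<forall>\<^sub>F n in sequentially. \<forall>x\<in>K.
         cmod (conv_power \<phi> n \<lfloor>\<alpha> q * real n + x * real n powr (1 / real m)\<rfloor> -
               (\<Sum>l = 1..card S. of_real (real n powr (- 1 / real m))
                  * exp (- \<i> * of_int \<lfloor>\<alpha> q * real n + x * real n powr (1 / real m)\<rfloor> * of_real (\<xi> (j l)))
                  * fourier \<phi> (\<xi> (j l)) ^ n * attractor m (\<beta> (j l)) x))
         \<le> \<epsilon> * real n powr (- 1 / real m)"
      using eventually_gt_at_top[of 0]
    proof eventually_elim
      case (elim n)
      define t where "t = real n powr (- 1 / real m)"
      have t: "t > 0" "t * real n powr (1 / real m) = 1"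
        using elim unfolding t_def by (auto simp flip: powr_add)
      have \<rho>t: "\<rho> ^ n \<le> \<eta> * t"
      proof -
        have "real n powr (1 / real m) \<le> real n powr 1" using elim m by (intro powr_mono) auto
        then have "\<rho> ^ n * real n powr (1 / real m) \<le> \<rho> ^ n * real n"
          using \<rho> by (intro mult_left_mono) auto
        then have "\<rho> ^ n * real n powr (1 / real m) \<le> \<eta>" using elim by (simp add: mult.commute)
        then have "(\<rho> ^ n * real n powr (1 / real m)) * t \<le> \<eta> * t" using t by (intro mult_right_mono) auto
        moreover have "(\<rho> ^ n * real n powr (1 / real m)) * t = \<rho> ^ n * (t * real n powr (1 / real m))"
          by (simp only: mult_ac)
        ultimately show ?thesis using t(2) by simp
      qed
      show ?case unfolding sum_S unfolding t_def[symmetric]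
      proof
        fix x assume x: "x \<in> K"
        define k where "k = \<lfloor>\<alpha> q * real n + x * real n powr (1 / real m)\<rfloor>"
        let ?v = "of_int k - \<alpha> q * real n"
        have "\<bar>?v - x * real n powr (1 / real m)\<bar> \<le> 1" unfolding k_def by linarith
        then have "t * \<bar>?v - x * real n powr (1 / real m)\<bar> \<le> t" using t(1) by simp
        moreover have "t * (?v - x * real n powr (1 / real m)) = ?v * t - x * (t * real n powr (1 / real m))"
          by (simp only: right_diff_distrib mult_ac)
        then have "\<bar>?v * t - x\<bar> = \<bar>t * (?v - x * real n powr (1 / real m))\<bar>" using t(2) by simp
        then have "\<bar>?v * t - x\<bar> = t * \<bar>?v - x * real n powr (1 / real m)\<bar>" using t(1) by (simp only: abs_mult abs_of_pos)
        ultimately have near: "\<bar>?v * t - x\<bar> \<le> t" by simp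
        let ?T = "\<Sum>p\<in>?\<Omega>. resonant_term \<phi> m (\<alpha> q) p n k x"
        have "cmod ((\<Sum>p\<in>?\<Omega>. ?I \<delta> p n k) - of_real (2 * pi) * ?T)
            \<le> (\<Sum>p\<in>?\<Omega>. cmod (?I \<delta> p n k - of_real (2 * pi) * resonant_term \<phi> m (\<alpha> q) p n k x))"
          unfolding sum_distrib_left sum_subtractf[symmetric] by (rule norm_sum)
        also have "\<dots> \<le> (\<Sum>p\<in>?\<Omega>. \<eta> * t)"
          using elim(1) X(2)[OF x] near unfolding t_def by (intro sum_mono) blast
        finally have near_part: "cmod ((\<Sum>p\<in>?\<Omega>. ?I \<delta> p n k) - of_real (2 * pi) * ?T) \<le> real (card ?\<Omega>) * (\<eta> * t)"
          by simp
        have "2 * pi * cmod (conv_power \<phi> n k - ?T) = cmod (of_real (2 * pi) * conv_power \<phi> n k - of_real (2 * pi) * ?T)"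
          unfolding right_diff_distrib[symmetric] norm_mult by simp
        also have "\<dots> \<le> \<rho> ^ n * (2 * pi) + real (card ?\<Omega>) * (\<eta> * t)"
          by (rule norm_diff_triangle_le[OF far near_part])
        also have "\<dots> \<le> (\<eta> * t) * (2 * pi) + (real (card ?\<Omega>) * (\<eta> * t)) * (2 * pi)"
        proof (rule add_mono)
          show "\<rho> ^ n * (2 * pi) \<le> \<eta> * t * (2 * pi)" using \<rho>t by (intro mult_right_mono) auto
          have "1 \<le> 2 * pi" using pi_gt3 by simp
          then show "real (card ?\<Omega>) * (\<eta> * t) \<le> real (card ?\<Omega>) * (\<eta> * t) * (2 * pi)"
            using mult_left_mono[OF \<open>1 \<le> 2 * pi\<close>, of "real (card ?\<Omega>) * (\<eta> * t)"] \<eta> t(1) by simp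
        qed
        also have "\<dots> = 2 * pi * ((real (card ?\<Omega>) + 1) * \<eta> * t)" by (simp add: algebra_simps)
        also have "(real (card ?\<Omega>) + 1) * \<eta> = \<epsilon>" by (simp add: \<eta>_def add_nonneg_eq_0_iff)
        finally show "cmod (conv_power \<phi> n \<lfloor>\<alpha> q * real n + x * real n powr (1 / real m)\<rfloor> -
            (\<Sum>p\<in>?\<Omega>. resonant_term \<phi> m (\<alpha> q) p n \<lfloor>\<alpha> q * real n + x * real n powr (1 / real m)\<rfloor> x)) \<le> \<epsilon> * t"
          unfolding k_def[symmetric] by simp
      qed
    qed
  qed
qed

end
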